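(* Let $A$ be a cocommutative Hopf algebra over a field $k$ and $M$ a left $A$-module. For each $n\ge 0$, the formulas $$(\sigma_if)(a_0\otimes\cdots\otimes a_n)=-f(a_0\otimes\cdots\otimes a_{i-1}a_i^{(1)}\otimes S(a_i^{(2)})\otimes a_i^{(3)}a_{i+1}\otimes\cdots\otimes a_n)\quad\text{for }1\le i\le n-1,$$ $$(\sigma_nf)(a_0\otimes\cdots\otimes a_n)=-f(a_0\otimes\cdots\otimes a_{n-1}a_n^{(1)}\otimes S(a_n^{(2)})),$$ for $f\in C^n(A,M)$ and $a_0,\dots,a_n\in A$, define an action of the symmetric group $S_{n+1}$ on $C^n(A,M)$, where $\sigma_i=(i,i+1)\in S_{n+1}$. This action is compatible with the differential $\delta_C^n:C^n(A,M)\to C^{n+1}(A,M)$, i.e. $\delta_C^n$ maps $C^n(A,M)^{S_{n+1}}$ into $C^{n+1}(A,M)^{S_{n+2}}$.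
   Context: $\otimes=\otimes_k$. $A$ has coproduct $\Delta$, counit $\varepsilon$ and antipode $S$; Sweedler notation $\Delta(a)=a^{(1)}\otimes a^{(2)}$ (summation suppressed, and similarly for iterated coproducts) is used. $A$ is cocommutative if $a^{(1)}\otimes a^{(2)}=a^{(2)}\otimes a^{(1)}$ for all $a\in A$. For $n\ge0$, $T_n(A)=A^{\otimes n+1}$ is a left $A$-module via $b\cdot(a_0\otimes a_1\otimes\cdots\otimes a_n)=ba_0\otimes a_1\otimes\cdots\otimes a_n$. For $n\ge1$, $d_n:T_n(A)\to T_{n-1}(A)$ is $$d_n(a_0\otimes\cdots\otimes a_n)=\sum_{i=0}^{n-1}(-1)^i a_0\otimes\cdots\otimes a_ia_{i+1}\otimes\cdots\otimes a_n+(-1)^n a_0\otimes\cdots\otimes a_{n-1}\varepsilon(a_n).$$ $C^n(A,M)=\mathrm{Hom}_A(T_n(A),M)$ and $\delta_C^n(f)=f\circ d_{n+1}$. For $n=0$ the group $S_1$ is trivial. *)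

theory Defs
  imports Complex_Main "HOL-Library.Poly_Mapping" "HOL-Algebra.Sym_Groups" "HOL-Algebra.Group_Action"
begin

section \<open>Tensor powers of a vector space\<close>

text \<open>
  The field is the type \<open>'k\<close>, and \<open>'a\<close> is a vector space over it with scalar multiplication
  \<open>scl\<close>.  The tensor power of order \<open>n\<close> is built in the usual way, as the quotient of the free
  vector space on the lists of length \<open>n\<close> by the relations expressing multilinearity.  A free
  vector is a finitely supported function \<open>'a list \<Rightarrow>\<^sub>0 'k\<close>, and a tensor is an equivalence class of
  free vectors.
\<close>

definition free_scale :: "'k::field \<Rightarrow> ('b \<Rightarrow>\<^sub>0 'k) \<Rightarrow> ('b \<Rightarrow>\<^sub>0 'k)"
  where "free_scale c u = Poly_Mapping.map ((*) c) u"

lemma lookup_free_scale [simp]: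
  "Poly_Mapping.lookup (free_scale c u) x = c * Poly_Mapping.lookup u x"
  by (simp add: free_scale_def Poly_Mapping.map.rep_eq when_def)

lemma vector_space_free_scale: "vector_space free_scale"
  by unfold_locales (auto intro!: poly_mapping_eqI simp: lookup_add algebra_simps)

definition free_space :: "nat \<Rightarrow> ('a list \<Rightarrow>\<^sub>0 'k::field) set"
  where "free_space n = {u. \<forall>xs\<in>Poly_Mapping.keys u. length xs = n}"

definition multilinear_relations ::
    "('k::field \<Rightarrow> 'a::ab_group_add \<Rightarrow> 'a) \<Rightarrow> nat \<Rightarrow> ('a list \<Rightarrow>\<^sub>0 'k) set"
  where "multilinear_relations scl n =
    {Poly_Mapping.single (xs @ (x + y) # ys) 1
        - Poly_Mapping.single (xs @ x # ys) 1 - Poly_Mapping.single (xs @ y # ys) 1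
       | xs x y ys. length xs + 1 + length ys = n} \<union>
    {Poly_Mapping.single (xs @ scl c x # ys) 1
        - free_scale c (Poly_Mapping.single (xs @ x # ys) 1)
       | xs c x ys. length xs + 1 + length ys = n}"

definition tensor_rel ::
    "('k::field \<Rightarrow> 'a::ab_group_add \<Rightarrow> 'a) \<Rightarrow> nat \<Rightarrow> (('a list \<Rightarrow>\<^sub>0 'k) \<times> ('a list \<Rightarrow>\<^sub>0 'k)) set"
  where "tensor_rel scl n =
    {(u, v). u \<in> free_space n \<and> v \<in> free_space n \<and>
       u - v \<in> Modules.module.span free_scale (multilinear_relations scl n)}"

lemma zero_in_free_space: "0 \<in> free_space n"
  by (simp add: free_space_def)

lemma equiv_tensor_rel: "equiv (free_space n) (tensor_rel scl n)"
proof -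
  interpret V: vector_space "free_scale :: 'k::field \<Rightarrow> ('a list \<Rightarrow>\<^sub>0 'k) \<Rightarrow> _"
    by (rule vector_space_free_scale)
  let ?N = "V.span (multilinear_relations scl n)"
  have neg: "v - u \<in> ?N" if "u - v \<in> ?N" for u v
    using V.span_neg[OF that] by simp
  have add: "u - w \<in> ?N" if "u - v \<in> ?N" "v - w \<in> ?N" for u v w
    using V.span_add[OF that] by simp
  show ?thesis
  proof (rule equivI)
    show "tensor_rel scl n \<subseteq> free_space n \<times> free_space n"
      by (auto simp: tensor_rel_def)
    show "refl_on (free_space n) (tensor_rel scl n)"
      by (auto simp: refl_on_def tensor_rel_def V.span_zero)
    show "sym (tensor_rel scl n)"
      by (auto simp: sym_def tensor_rel_def intro: neg)
    show "trans (tensor_rel scl n)"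
      unfolding trans_def tensor_rel_def using add by blast
  qed
qed

type_synonym ('a, 'k) tensor = "('a list \<Rightarrow>\<^sub>0 'k) set"

definition tensor_power ::
    "('k::field \<Rightarrow> 'a::ab_group_add \<Rightarrow> 'a) \<Rightarrow> nat \<Rightarrow> ('a, 'k) tensor set"
  where "tensor_power scl n = free_space n // tensor_rel scl n"

definition tensor_class ::
    "('k::field \<Rightarrow> 'a::ab_group_add \<Rightarrow> 'a) \<Rightarrow> nat \<Rightarrow> ('a list \<Rightarrow>\<^sub>0 'k) \<Rightarrow> ('a, 'k) tensor"
  where "tensor_class scl n u = tensor_rel scl n `` {u}"

definition pure_tensor ::
    "('k::field \<Rightarrow> 'a::ab_group_add \<Rightarrow> 'a) \<Rightarrow> 'a list \<Rightarrow> ('a, 'k) tensor"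
  where "pure_tensor scl xs = tensor_class scl (length xs) (Poly_Mapping.single xs 1)"

definition tensor_rep :: "('a, 'k) tensor \<Rightarrow> ('a list \<Rightarrow>\<^sub>0 'k::field)"
  where "tensor_rep X = (SOME u. u \<in> X)"

definition tensor_add ::
    "('k::field \<Rightarrow> 'a::ab_group_add \<Rightarrow> 'a) \<Rightarrow> nat \<Rightarrow> ('a, 'k) tensor \<Rightarrow> ('a, 'k) tensor \<Rightarrow> ('a, 'k) tensor"
  where "tensor_add scl n X Y = tensor_class scl n (tensor_rep X + tensor_rep Y)"

definition tensor_scale ::
    "('k::field \<Rightarrow> 'a::ab_group_add \<Rightarrow> 'a) \<Rightarrow> nat \<Rightarrow> 'k \<Rightarrow> ('a, 'k) tensor \<Rightarrow> ('a, 'k) tensor"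
  where "tensor_scale scl n c X = tensor_class scl n (free_scale c (tensor_rep X))"

definition lin_ext ::
    "('k::field \<Rightarrow> 'v \<Rightarrow> 'v::ab_group_add) \<Rightarrow> ('b \<Rightarrow> 'v) \<Rightarrow> ('b \<Rightarrow>\<^sub>0 'k) \<Rightarrow> 'v"
  where "lin_ext sc g u = (\<Sum>x\<in>Poly_Mapping.keys u. sc (Poly_Mapping.lookup u x) (g x))"

text \<open>
  \<open>tensor_lift sc g X\<close> is the value at \<open>X\<close> of the linear map that sends the pure tensor of \<open>xs\<close> to
  \<open>g xs\<close>, for a multilinear \<open>g\<close> with values in a vector space with scalar multiplication \<open>sc\<close>.  It
  also renders Sweedler notation: \<open>\<Sum> g a\<^sup>1 a\<^sup>2\<close> is \<open>tensor_lift sc (\<lambda>t. g (t ! 0) (t ! 1)) (\<Delta> a)\<close>.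
  \<open>tensor_map scl m g X\<close> is the same with values in the tensor power of order \<open>m\<close>, where \<open>g xs\<close>
  is a representative of the value at the pure tensor of \<open>xs\<close>.  The choice of representatives
  does not matter when \<open>g\<close> is multilinear (for \<open>tensor_map\<close>: modulo the relations), and the two
  operations are only used for such \<open>g\<close>.
\<close>

definition tensor_lift ::
    "('k::field \<Rightarrow> 'v \<Rightarrow> 'v::ab_group_add) \<Rightarrow> ('a list \<Rightarrow> 'v) \<Rightarrow> ('a, 'k) tensor \<Rightarrow> 'v"
  where "tensor_lift sc g X = lin_ext sc g (tensor_rep X)"

definition tensor_map ::
    "('k::field \<Rightarrow> 'a::ab_group_add \<Rightarrow> 'a) \<Rightarrow> nat \<Rightarrow> ('a list \<Rightarrow> ('a list \<Rightarrow>\<^sub>0 'k)) \<Rightarrow>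
      ('a, 'k) tensor \<Rightarrow> ('a, 'k) tensor"
  where "tensor_map scl m g X = tensor_class scl m (lin_ext free_scale g (tensor_rep X))"

text \<open>Juxtaposition of free vectors, representing the product \<open>(u, v) \<mapsto> u \<otimes> v\<close> of tensors.\<close>

definition free_cat :: "('a list \<Rightarrow>\<^sub>0 'k::field) \<Rightarrow> ('a list \<Rightarrow>\<^sub>0 'k) \<Rightarrow> ('a list \<Rightarrow>\<^sub>0 'k)"
  where "free_cat u v =
    lin_ext free_scale (\<lambda>xs. lin_ext free_scale (\<lambda>ys. Poly_Mapping.single (xs @ ys) 1) v) u"

text \<open>The product of the algebra \<open>A \<otimes> \<dots> \<otimes> A\<close>: factorwise on pure tensors.\<close>

definition tensor_mult ::
    "('k::field \<Rightarrow> 'a::ring_1 \<Rightarrow> 'a) \<Rightarrow> nat \<Rightarrow> ('a, 'k) tensor \<Rightarrow> ('a, 'k) tensor \<Rightarrow> ('a, 'k) tensor"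
  where "tensor_mult scl n X Y =
    tensor_map scl n
      (\<lambda>xs. lin_ext free_scale (\<lambda>ys. Poly_Mapping.single (map2 (*) xs ys) 1) (tensor_rep Y)) X"


section \<open>Hopf algebras\<close>

text \<open>The maps \<open>\<Delta> \<otimes> id\<close> and \<open>id \<otimes> \<Delta>\<close> from \<open>A \<otimes> A\<close> to \<open>A \<otimes> A \<otimes> A\<close>.\<close>

definition comult_left ::
    "('k::field \<Rightarrow> 'a::ab_group_add \<Rightarrow> 'a) \<Rightarrow> ('a \<Rightarrow> ('a, 'k) tensor) \<Rightarrow> ('a, 'k) tensor \<Rightarrow> ('a, 'k) tensor"
  where "comult_left scl \<Delta> =
    tensor_map scl 3 (\<lambda>t. free_cat (tensor_rep (\<Delta> (t ! 0))) (Poly_Mapping.single [t ! 1] 1))"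

definition comult_right ::
    "('k::field \<Rightarrow> 'a::ab_group_add \<Rightarrow> 'a) \<Rightarrow> ('a \<Rightarrow> ('a, 'k) tensor) \<Rightarrow> ('a, 'k) tensor \<Rightarrow> ('a, 'k) tensor"
  where "comult_right scl \<Delta> =
    tensor_map scl 3 (\<lambda>t. free_cat (Poly_Mapping.single [t ! 0] 1) (tensor_rep (\<Delta> (t ! 1))))"

text \<open>
  The class \<open>ring_1\<close> demands \<open>0 \<noteq> 1\<close>.  This loses nothing, since the counit maps \<open>1\<close> to \<open>1\<close>.
\<close>

locale hopf_algebra = vector_space scl
  for scl :: "'k::field \<Rightarrow> 'a::ring_1 \<Rightarrow> 'a" +
  fixes \<Delta> :: "'a \<Rightarrow> ('a, 'k) tensor"
    and \<epsilon> :: "'a \<Rightarrow> 'k"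
    and S :: "'a \<Rightarrow> 'a"
  assumes scl_mult_left: "scl c x * y = scl c (x * y)"
    and scl_mult_right: "x * scl c y = scl c (x * y)"
    and comult_closed: "\<Delta> x \<in> tensor_power scl 2"
    and comult_add: "\<Delta> (x + y) = tensor_add scl 2 (\<Delta> x) (\<Delta> y)"
    and comult_scl: "\<Delta> (scl c x) = tensor_scale scl 2 c (\<Delta> x)"
    and counit_linear: "Vector_Spaces.linear scl (*) \<epsilon>"
    and coassoc: "comult_left scl \<Delta> (\<Delta> x) = comult_right scl \<Delta> (\<Delta> x)"
    and counit_left: "tensor_lift scl (\<lambda>t. scl (\<epsilon> (t ! 0)) (t ! 1)) (\<Delta> x) = x"
    and counit_right: "tensor_lift scl (\<lambda>t. scl (\<epsilon> (t ! 1)) (t ! 0)) (\<Delta> x) = x"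
    and comult_mult: "\<Delta> (x * y) = tensor_mult scl 2 (\<Delta> x) (\<Delta> y)"
    and comult_one: "\<Delta> 1 = pure_tensor scl [1, 1]"
    and counit_mult: "\<epsilon> (x * y) = \<epsilon> x * \<epsilon> y"
    and counit_one: "\<epsilon> 1 = 1"
    and antipode_linear: "Vector_Spaces.linear scl scl S"
    and antipode_left: "tensor_lift scl (\<lambda>t. S (t ! 0) * t ! 1) (\<Delta> x) = scl (\<epsilon> x) 1"
    and antipode_right: "tensor_lift scl (\<lambda>t. t ! 0 * S (t ! 1)) (\<Delta> x) = scl (\<epsilon> x) 1"

locale cocommutative_hopf_algebra = hopf_algebra +
  assumes cocommutative: "tensor_map scl 2 (\<lambda>t. Poly_Mapping.single [t ! 1, t ! 0] 1) (\<Delta> x) = \<Delta> x"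

text \<open>The locale \<open>module\<close> of the library is restricted to commutative rings of scalars.\<close>

locale left_module =
  fixes act :: "'a::ring_1 \<Rightarrow> 'm::ab_group_add \<Rightarrow> 'm"
  assumes act_add_right: "act a (m + m') = act a m + act a m'"
    and act_add_left: "act (a + b) m = act a m + act b m"
    and act_act: "act a (act b m) = act (a * b) m"
    and act_one: "act 1 m = m"

text \<open>The vector space structure that a left \<open>A\<close>-module inherits from \<open>k \<rightarrow> A\<close>.\<close>

definition module_scale ::
    "('k::field \<Rightarrow> 'a::ring_1 \<Rightarrow> 'a) \<Rightarrow> ('a \<Rightarrow> 'm::ab_group_add \<Rightarrow> 'm) \<Rightarrow> 'k \<Rightarrow> 'm \<Rightarrow> 'm"
  where "module_scale scl act c m = act (scl c 1) m"


section \<open>The complex \<open>C\<^sup>n(A, M)\<close>\<close>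

text \<open>\<open>T\<^sub>n(A)\<close> is \<open>tensor_power scl (n + 1)\<close>, and \<open>T_act scl n\<close> is its \<open>A\<close>-module structure.\<close>

definition T_act ::
    "('k::field \<Rightarrow> 'a::ring_1 \<Rightarrow> 'a) \<Rightarrow> nat \<Rightarrow> 'a \<Rightarrow> ('a, 'k) tensor \<Rightarrow> ('a, 'k) tensor"
  where "T_act scl n b = tensor_map scl (n + 1) (\<lambda>as. Poly_Mapping.single (b * hd as # tl as) 1)"

definition merge_at :: "nat \<Rightarrow> 'a::ring_1 list \<Rightarrow> 'a list"
  where "merge_at i as = take i as @ (as ! i * as ! (i + 1)) # drop (i + 2) as"

text \<open>The differential \<open>d\<^sub>n : T\<^sub>n(A) \<rightarrow> T\<^sub>n\<^sub>-\<^sub>1(A)\<close>, for \<open>n \<ge> 1\<close>.\<close>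

definition T_diff ::
    "('k::field \<Rightarrow> 'a::ring_1 \<Rightarrow> 'a) \<Rightarrow> ('a \<Rightarrow> 'k) \<Rightarrow> nat \<Rightarrow> ('a, 'k) tensor \<Rightarrow> ('a, 'k) tensor"
  where "T_diff scl \<epsilon> n =
    tensor_map scl n
      (\<lambda>as. (\<Sum>i<n. free_scale ((- 1) ^ i) (Poly_Mapping.single (merge_at i as) 1))
            + free_scale ((- 1) ^ n * \<epsilon> (as ! n)) (Poly_Mapping.single (take n as) 1))"

text \<open>
  Cochains are normalised to \<open>0\<close> outside \<open>T\<^sub>n(A)\<close>, so that equality of cochains is equality of
  functions and their sums are pointwise.
\<close>

definition cochains ::
    "('k::field \<Rightarrow> 'a::ring_1 \<Rightarrow> 'a) \<Rightarrow> ('a \<Rightarrow> 'm::ab_group_add \<Rightarrow> 'm) \<Rightarrow> nat \<Rightarrow>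
      (('a, 'k) tensor \<Rightarrow> 'm) set"
  where "cochains scl act n =
    {f. (\<forall>X. X \<notin> tensor_power scl (n + 1) \<longrightarrow> f X = 0) \<and>
        (\<forall>X\<in>tensor_power scl (n + 1). \<forall>Y\<in>tensor_power scl (n + 1).
           f (tensor_add scl (n + 1) X Y) = f X + f Y) \<and>
        (\<forall>b. \<forall>X\<in>tensor_power scl (n + 1). f (T_act scl n b X) = act b (f X))}"

definition coboundary ::
    "('k::field \<Rightarrow> 'a::ring_1 \<Rightarrow> 'a) \<Rightarrow> ('a \<Rightarrow> 'k) \<Rightarrow> nat \<Rightarrow>
      (('a, 'k) tensor \<Rightarrow> 'm::ab_group_add) \<Rightarrow> (('a, 'k) tensor \<Rightarrow> 'm)"
  where "coboundary scl \<epsilon> n f =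
    (\<lambda>X. if X \<in> tensor_power scl (n + 2) then f (T_diff scl \<epsilon> (n + 1) X) else 0)"


section \<open>The action of the symmetric groups\<close>

text \<open>
  \<open>sigma_formula scl \<Delta> S act n i f as\<close> is the element \<open>(\<sigma>\<^sub>i f)(a\<^sub>0 \<otimes> \<dots> \<otimes> a\<^sub>n)\<close> of \<open>M\<close>, where \<open>as\<close> is
  the list \<open>a\<^sub>0, \<dots>, a\<^sub>n\<close> and \<open>1 \<le> i \<le> n\<close>.
\<close>

definition sigma_formula ::
    "('k::field \<Rightarrow> 'a::ring_1 \<Rightarrow> 'a) \<Rightarrow> ('a \<Rightarrow> ('a, 'k) tensor) \<Rightarrow> ('a \<Rightarrow> 'a) \<Rightarrow>
      ('a \<Rightarrow> 'm::ab_group_add \<Rightarrow> 'm) \<Rightarrow> nat \<Rightarrow> nat \<Rightarrow> (('a, 'k) tensor \<Rightarrow> 'm) \<Rightarrow> 'a list \<Rightarrow> 'm"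
  where "sigma_formula scl \<Delta> S act n i f as =
    (if i < n then
       - tensor_lift (module_scale scl act)
           (\<lambda>t. f (pure_tensor scl
              (as[i - 1 := as ! (i - 1) * t ! 0, i := S (t ! 1), i + 1 := t ! 2 * as ! (i + 1)])))
           (comult_left scl \<Delta> (\<Delta> (as ! i)))
     else
       - tensor_lift (module_scale scl act)
           (\<lambda>t. f (pure_tensor scl (as[i - 1 := as ! (i - 1) * t ! 0, i := S (t ! 1)])))
           (\<Delta> (as ! i)))"

text \<open>
  \<open>\<rho>\<close> is an action of \<open>S\<^sub>n\<^sub>+\<^sub>1\<close> on \<open>C\<^sup>n(A, M)\<close> by linear maps, in which the transpositions
  \<open>\<sigma>\<^sub>i = (i, i + 1)\<close> act by the formulas.
\<close>

definition is_sigma_action ::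
    "('k::field \<Rightarrow> 'a::ring_1 \<Rightarrow> 'a) \<Rightarrow> ('a \<Rightarrow> ('a, 'k) tensor) \<Rightarrow> ('a \<Rightarrow> 'a) \<Rightarrow>
      ('a \<Rightarrow> 'm::ab_group_add \<Rightarrow> 'm) \<Rightarrow> nat \<Rightarrow>
      ((nat \<Rightarrow> nat) \<Rightarrow> (('a, 'k) tensor \<Rightarrow> 'm) \<Rightarrow> (('a, 'k) tensor \<Rightarrow> 'm)) \<Rightarrow> bool"
  where "is_sigma_action scl \<Delta> S act n \<rho> \<longleftrightarrow>
    group_action (sym_group (n + 1)) (cochains scl act n) \<rho> \<and>
    (\<forall>\<pi>\<in>carrier (sym_group (n + 1)). \<forall>f\<in>cochains scl act n. \<forall>g\<in>cochains scl act n.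
       \<rho> \<pi> (\<lambda>X. f X + g X) = (\<lambda>X. \<rho> \<pi> f X + \<rho> \<pi> g X)) \<and>
    (\<forall>\<pi>\<in>carrier (sym_group (n + 1)). \<forall>c. \<forall>f\<in>cochains scl act n.
       \<rho> \<pi> (\<lambda>X. module_scale scl act c (f X)) = (\<lambda>X. module_scale scl act c (\<rho> \<pi> f X))) \<and>
    (\<forall>i\<in>{1..n}. \<forall>f\<in>cochains scl act n. \<forall>as. length as = n + 1 \<longrightarrow>
       \<rho> (transpose i (i + 1)) f (pure_tensor scl as) = sigma_formula scl \<Delta> S act n i f as)"

definition invariant_cochains ::
    "('k::field \<Rightarrow> 'a::ring_1 \<Rightarrow> 'a) \<Rightarrow> ('a \<Rightarrow> 'm::ab_group_add \<Rightarrow> 'm) \<Rightarrow> nat \<Rightarrow>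
      ((nat \<Rightarrow> nat) \<Rightarrow> (('a, 'k) tensor \<Rightarrow> 'm) \<Rightarrow> (('a, 'k) tensor \<Rightarrow> 'm)) \<Rightarrow>
      (('a, 'k) tensor \<Rightarrow> 'm) set"
  where "invariant_cochains scl act n \<rho> =
    (\<Inter>\<pi>\<in>carrier (sym_group (n + 1)). invariants (cochains scl act n) \<rho> \<pi>)"

end

theory Submission
  imports Defs
begin

text \<open>
  For a group algebra and group elements \<open>a\<^sub>0, \<dots>, a\<^sub>n\<close>, put \<open>h\<^sub>i = a\<^sub>0 \<cdots> a\<^sub>i\<close>.  In these homogeneous
  coordinates the formula for \<open>\<sigma>\<^sub>i\<close> exchanges \<open>h\<^sub>i\<^sub>-\<^sub>1\<close> and \<open>h\<^sub>i\<close> and changes the sign, and the differential is the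
  alternating sum over the deletions of one coordinate.  So the action is the permutation of the
  \<open>n + 1\<close> coordinates twisted by the sign, the invariants are the alternating functions, and the
  alternating sum of the deletions of an alternating function is alternating.

  A cocommutative Hopf algebra allows the same change of coordinates,
  \<open>a\<^sub>0 \<otimes> a\<^sub>1 \<otimes> a\<^sub>2 \<otimes> \<dots> \<mapsto> \<Sum> a\<^sub>0\<^sup>1 \<otimes> a\<^sub>0\<^sup>2 a\<^sub>1\<^sup>1 \<otimes> a\<^sub>0\<^sup>3 a\<^sub>1\<^sup>2 a\<^sub>2\<^sup>1 \<otimes> \<dots>\<close>.  It is a product of shears
  \<open>x \<otimes> y \<mapsto> \<Sum> x\<^sup>1 \<otimes> x\<^sup>2 y\<close> in consecutive positions, and such a shear has the inverse
  \<open>x \<otimes> y \<mapsto> \<Sum> x\<^sup>1 \<otimes> S x\<^sup>2 y\<close>; the lemmas \<open>to_of_homogeneous\<close> and \<open>of_to_homogeneous\<close> follow.  The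
  permutation of the coordinates is then an action for trivial reasons (\<open>perm_action_comp\<close>), and the
  point is that the formulas for \<open>\<sigma>\<^sub>i\<close> are the conjugates of the neighbouring exchanges.  This is
  \<open>hopf_swap_conjugate_swap\<close>.  It reduces by induction along the list to an identity in three tensor
  factors, \<open>sweedler_conjugated_swap\<close>, which is the place where cocommutativity is used.

  The exchanges of neighbours generate the symmetric group, whence \<open>A\<close>-linearity of the action, its
  uniqueness, and the reduction of invariance to the \<open>\<sigma>\<^sub>i\<close>.  The differential is handled directly with
  the formulas: in \<open>hopf_swap_differential\<close> the antipode contracts the two faces that delete one of the
  exchanged coordinates, and the other faces commute with the exchange by associativity.

  All computations are made with multilinear functions on lists instead of linear maps on tensor
  powers.  The universal property of the tensor power translates between the two.
\<close>

section \<open>Linear extension from free vectors\<close>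

lemma (in vector_space) lin_ext_eq_sum:
  assumes "finite A" "Poly_Mapping.keys u \<subseteq> A"
  shows "lin_ext scale g u = (\<Sum>x\<in>A. scale (Poly_Mapping.lookup u x) (g x))"
  unfolding lin_ext_def using assms
  by (intro sum.mono_neutral_left) (auto simp: in_keys_iff)

lemma (in vector_space) lin_ext_add:
  "lin_ext scale g (u + v) = lin_ext scale g u + lin_ext scale g v"
proof -
  let ?A = "Poly_Mapping.keys u \<union> Poly_Mapping.keys v"
  have "Poly_Mapping.keys (u + v) \<subseteq> ?A"
    by (rule Poly_Mapping.keys_add)
  then show ?thesis
    by (simp add: lin_ext_eq_sum[of ?A] lookup_add scale_left_distrib sum.distrib)
qed

lemma (in vector_space) lin_ext_free_scale:
  "lin_ext scale g (free_scale c u) = scale c (lin_ext scale g u)"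
proof -
  have "Poly_Mapping.keys (free_scale c u) \<subseteq> Poly_Mapping.keys u"
    by (auto simp: in_keys_iff)
  then show ?thesis
    by (simp add: lin_ext_eq_sum[of "Poly_Mapping.keys u"] scale_sum_right)
qed

lemma (in vector_space) lin_ext_zero [simp]: "lin_ext scale g 0 = 0"
  by (simp add: lin_ext_def)

lemma (in vector_space) lin_ext_single [simp]: "lin_ext scale g (Poly_Mapping.single x c) = scale c (g x)"
  by (cases "c = 0") (simp_all add: lin_ext_def)

lemma (in vector_space) lin_ext_diff:
  "lin_ext scale g (u - v) = lin_ext scale g u - lin_ext scale g v"
  using lin_ext_add[of g "u - v" v] by (simp add: algebra_simps)

lemma (in vector_space) lin_ext_sum:
  "lin_ext scale g (\<Sum>i\<in>I. u i) = (\<Sum>i\<in>I. lin_ext scale g (u i))"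
  by (induction I rule: infinite_finite_induct) (simp_all add: lin_ext_add)

lemma lin_ext_cong:
  "(\<And>x. x \<in> Poly_Mapping.keys u \<Longrightarrow> g x = h x) \<Longrightarrow> lin_ext sc g u = lin_ext sc h u"
  by (simp add: lin_ext_def)

lemma (in vector_space) lin_ext_lin_ext:
  "lin_ext scale h (lin_ext free_scale g u) = lin_ext scale (\<lambda>x. lin_ext scale h (g x)) u"
  unfolding lin_ext_def[of free_scale] lin_ext_sum lin_ext_free_scale
  by (simp add: lin_ext_def)

lemma linear_lin_ext:
  assumes "Vector_Spaces.linear s1 s2 L"
  shows "L (lin_ext s1 g u) = lin_ext s2 (\<lambda>x. L (g x)) u"
proof -
  interpret L: Vector_Spaces.linear s1 s2 L by (rule assms)
  show ?thesis by (simp add: lin_ext_def L.sum L.scale)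
qed

lemma linear_additive: "Vector_Spaces.linear s1 s2 f \<Longrightarrow> f (x + y) = f x + f y"
  and linear_homogeneous: "Vector_Spaces.linear s1 s2 f \<Longrightarrow> f (s1 c x) = s2 c (f x)"
  by (auto simp: Vector_Spaces.linear_iff)

lemma free_space_add: "u \<in> free_space n \<Longrightarrow> v \<in> free_space n \<Longrightarrow> u + v \<in> free_space n"
  using Poly_Mapping.keys_add[of u v] by (auto simp: free_space_def)

lemma free_space_scale: "u \<in> free_space n \<Longrightarrow> free_scale c u \<in> free_space n"
  by (auto simp: free_space_def in_keys_iff)

lemma free_space_single: "length xs = n \<Longrightarrow> Poly_Mapping.single xs c \<in> free_space n"
  by (auto simp: free_space_def in_keys_iff lookup_single when_def)

lemma free_space_sum: "(\<And>i. i \<in> I \<Longrightarrow> u i \<in> free_space n) \<Longrightarrow> (\<Sum>i\<in>I. u i) \<in> free_space n"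
  by (induction I rule: infinite_finite_induct) (simp_all add: free_space_add zero_in_free_space)

lemma free_space_lin_ext:
  assumes "\<And>xs. xs \<in> Poly_Mapping.keys u \<Longrightarrow> g xs \<in> free_space n"
  shows "lin_ext free_scale g u \<in> free_space n"
  unfolding lin_ext_def using assms by (intro free_space_sum free_space_scale)

lemma length_free_space: "u \<in> free_space n \<Longrightarrow> xs \<in> Poly_Mapping.keys u \<Longrightarrow> length xs = n"
  by (simp add: free_space_def)

lemma multilinear_relation_add:
  "length xs + 1 + length ys = n \<Longrightarrow>
    Poly_Mapping.single (xs @ (x + y) # ys) 1
      - Poly_Mapping.single (xs @ x # ys) 1 - Poly_Mapping.single (xs @ y # ys) 1
    \<in> multilinear_relations scl n"
  unfolding multilinear_relations_def by blast

lemma multilinear_relation_scale: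
  "length xs + 1 + length ys = n \<Longrightarrow>
    Poly_Mapping.single (xs @ scl c x # ys) 1 - free_scale c (Poly_Mapping.single (xs @ x # ys) 1)
    \<in> multilinear_relations scl n"
  unfolding multilinear_relations_def by blast

section \<open>Tensor classes and multilinear functions\<close>

lemma tensor_class_mem: "u \<in> free_space n \<Longrightarrow> u \<in> tensor_class scl n u"
  using equiv_class_self[OF equiv_tensor_rel] by (simp add: tensor_class_def)

lemma tensor_class_in: "u \<in> free_space n \<Longrightarrow> tensor_class scl n u \<in> tensor_power scl n"
  by (simp add: tensor_class_def tensor_power_def quotientI)

lemma tensor_class_eqI:
  "u \<in> free_space n \<Longrightarrow> v \<in> free_space n \<Longrightarrow>
    u - v \<in> Modules.module.span free_scale (multilinear_relations scl n) \<Longrightarrow>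
    tensor_class scl n u = tensor_class scl n v"
  unfolding tensor_class_def
  by (rule equiv_class_eq[OF equiv_tensor_rel]) (simp add: tensor_rel_def)

lemma tensor_rep_class:
  assumes "u \<in> free_space n"
  shows "tensor_rep (tensor_class scl n u) \<in> free_space n"
    and "u - tensor_rep (tensor_class scl n u)
          \<in> Modules.module.span free_scale (multilinear_relations scl n)"
proof -
  have "tensor_rep (tensor_class scl n u) \<in> tensor_class scl n u"
    unfolding tensor_rep_def using tensor_class_mem[OF assms] by (rule someI)
  then show "tensor_rep (tensor_class scl n u) \<in> free_space n"
    and "u - tensor_rep (tensor_class scl n u)
          \<in> Modules.module.span free_scale (multilinear_relations scl n)"
    by (auto simp: tensor_class_def tensor_rel_def)
qed

lemma tensor_power_rep:
  assumes "X \<in> tensor_power scl n"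
  shows "tensor_rep X \<in> free_space n" "tensor_class scl n (tensor_rep X) = X"
proof -
  obtain u where u: "u \<in> free_space n" "X = tensor_class scl n u"
    using assms by (auto simp: tensor_power_def tensor_class_def elim!: quotientE)
  show rep: "tensor_rep X \<in> free_space n"
    unfolding u(2) by (rule tensor_rep_class(1)[OF u(1)])
  show "tensor_class scl n (tensor_rep X) = X"
    using tensor_class_eqI[OF u(1) rep, of scl] tensor_rep_class(2)[OF u(1), of scl] u(2) by metis
qed

lemma tensor_add_class:
  fixes scl :: "'k::field \<Rightarrow> 'a::ab_group_add \<Rightarrow> 'a"
  assumes "u \<in> free_space n" "v \<in> free_space n"
  shows "tensor_add scl n (tensor_class scl n u) (tensor_class scl n v) = tensor_class scl n (u + v)"
proof -
  interpret V: vector_space "free_scale :: 'k \<Rightarrow> ('a list \<Rightarrow>\<^sub>0 'k) \<Rightarrow> _"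
    by (rule vector_space_free_scale)
  let ?u = "tensor_rep (tensor_class scl n u)" and ?v = "tensor_rep (tensor_class scl n v)"
  have "(u + v) - (?u + ?v) \<in> V.span (multilinear_relations scl n)"
    using V.span_add[OF tensor_rep_class(2)[OF assms(1), of scl] tensor_rep_class(2)[OF assms(2), of scl]]
    by (simp add: algebra_simps)
  then show ?thesis
    unfolding tensor_add_def
    by (intro tensor_class_eqI[symmetric] free_space_add assms tensor_rep_class(1))
qed

text \<open>
  A function on lists of length \<open>n\<close> that is linear in every entry.  Cochains are studied through such
  functions, which spares all computations inside tensor powers.
\<close>

definition multilinear ::
    "('k::field \<Rightarrow> 'a::ab_group_add \<Rightarrow> 'a) \<Rightarrow> ('k \<Rightarrow> 'v::ab_group_add \<Rightarrow> 'v) \<Rightarrow> nat \<Rightarrow>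
      ('a list \<Rightarrow> 'v) \<Rightarrow> bool"
  where "multilinear scl sc n F \<longleftrightarrow>
    (\<forall>xs ys. length xs + 1 + length ys = n \<longrightarrow> Vector_Spaces.linear scl sc (\<lambda>x. F (xs @ x # ys)))"

lemma multilinear_Suc:
  fixes scl :: "'k::field \<Rightarrow> 'a::ab_group_add \<Rightarrow> 'a" and sc :: "'k \<Rightarrow> 'v::ab_group_add \<Rightarrow> 'v"
  shows
  "multilinear scl sc (Suc n) F \<longleftrightarrow>
    (\<forall>ys. length ys = n \<longrightarrow> Vector_Spaces.linear scl sc (\<lambda>x. F (x # ys))) \<and>
    (\<forall>x. multilinear scl sc n (\<lambda>ys. F (x # ys)))" (is "?L = ?R")
proof
  assume L: ?L
  show ?R
    unfolding multilinear_def
  proof (intro conjI allI impI)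
    fix ys :: "'a list" assume "length ys = n"
    then show "Vector_Spaces.linear scl sc (\<lambda>x. F (x # ys))"
      using L[unfolded multilinear_def, rule_format, of "[]" ys] by simp
  next
    fix x :: 'a and xs ys :: "'a list" assume "length xs + 1 + length ys = n"
    then show "Vector_Spaces.linear scl sc (\<lambda>xa. F (x # xs @ xa # ys))"
      using L[unfolded multilinear_def, rule_format, of "x # xs" ys] by simp
  qed
next
  assume R: ?R
  show ?L
    unfolding multilinear_def
  proof (intro allI impI)
    fix xs ys :: "'a list" assume "length xs + 1 + length ys = Suc n"
    then show "Vector_Spaces.linear scl sc (\<lambda>x. F (xs @ x # ys))"
      using R by (cases xs) (auto simp: multilinear_def)
  qed
qed

lemma multilinear_0: "multilinear scl sc 0 F"
  by (simp add: multilinear_def)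

text \<open>
  This is the universal property of the tensor power: the linear extension of a multilinear function
  kills each generator of the relations, hence their span, hence is constant on tensor classes.
\<close>

lemma lin_ext_relation:
  fixes sc :: "'k::field \<Rightarrow> 'v::ab_group_add \<Rightarrow> 'v"
  assumes "vector_space sc" "multilinear scl sc n F"
    and "r \<in> Modules.module.span free_scale (multilinear_relations scl n)"
  shows "lin_ext sc F r = 0"
proof -
  interpret V: vector_space sc by fact
  interpret U: vector_space "free_scale :: 'k \<Rightarrow> ('b list \<Rightarrow>\<^sub>0 'k) \<Rightarrow> _"
    by (rule vector_space_free_scale)
  have base: "lin_ext sc F r = 0" if "r \<in> multilinear_relations scl n" for r
    using that unfolding multilinear_relations_def
  proof (elim UnE CollectE exE conjE)
    fix xs x y ys
    assume r: "r = Poly_Mapping.single (xs @ (x + y) # ys) 1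
        - Poly_Mapping.single (xs @ x # ys) 1 - Poly_Mapping.single (xs @ y # ys) 1"
      and "length xs + 1 + length ys = n"
    then have "Vector_Spaces.linear scl sc (\<lambda>x. F (xs @ x # ys))"
      using assms(2) by (simp add: multilinear_def)
    from linear_additive[OF this, of x y] show ?thesis
      by (simp add: r V.lin_ext_diff)
  next
    fix xs x c ys
    assume r: "r = Poly_Mapping.single (xs @ scl c x # ys) 1
        - free_scale c (Poly_Mapping.single (xs @ x # ys) 1)"
      and "length xs + 1 + length ys = n"
    then have "Vector_Spaces.linear scl sc (\<lambda>x. F (xs @ x # ys))"
      using assms(2) by (simp add: multilinear_def)
    from linear_homogeneous[OF this, of c x] show ?thesis
      by (simp add: r V.lin_ext_diff V.lin_ext_free_scale)
  qed
  show ?thesis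
    using assms(3)
  proof (induction rule: U.span_induct_alt)
    case base then show ?case by simp
  next
    case (step c x y)
    then show ?case by (simp add: V.lin_ext_add V.lin_ext_free_scale base)
  qed
qed

lemma tensor_lift_class:
  assumes "vector_space sc" "multilinear scl sc n F" "u \<in> free_space n"
  shows "tensor_lift sc F (tensor_class scl n u) = lin_ext sc F u"
proof -
  interpret V: vector_space sc by fact
  have "lin_ext sc F (u - tensor_rep (tensor_class scl n u)) = 0"
    by (rule lin_ext_relation[OF assms(1,2) tensor_rep_class(2)[OF assms(3)]])
  then show ?thesis
    by (simp add: tensor_lift_def V.lin_ext_diff)
qed

lemma tensor_lift_pure:
  assumes "vector_space sc" "multilinear scl sc n F" "length xs = n"
  shows "tensor_lift sc F (pure_tensor scl xs) = F xs"
proof -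
  interpret V: vector_space sc by fact
  show ?thesis
    unfolding pure_tensor_def using assms(3)
    by (simp add: tensor_lift_class[OF assms(1,2)] free_space_single)
qed

lemma tensor_lift_map:
  assumes "vector_space sc" "multilinear scl sc m F"
    and "X \<in> tensor_power scl n" "\<And>xs. length xs = n \<Longrightarrow> g xs \<in> free_space m"
  shows "tensor_lift sc F (tensor_map scl m g X) = tensor_lift sc (\<lambda>xs. lin_ext sc F (g xs)) X"
proof -
  interpret V: vector_space sc by fact
  have "lin_ext free_scale g (tensor_rep X) \<in> free_space m"
    using assms(3,4) by (intro free_space_lin_ext) (metis length_free_space tensor_power_rep(1))
  from tensor_lift_class[OF assms(1,2) this] show ?thesis
    by (simp add: tensor_map_def tensor_lift_def V.lin_ext_lin_ext)
qed

lemma tensor_lift_cong: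
  assumes "X \<in> tensor_power scl n" "\<And>xs. length xs = n \<Longrightarrow> F xs = G xs"
  shows "tensor_lift sc F X = tensor_lift sc G X"
  unfolding tensor_lift_def
  by (rule lin_ext_cong) (metis assms length_free_space tensor_power_rep(1))

lemma tensor_lift_add_tensor:
  assumes "vector_space sc" "multilinear scl sc n F" "X \<in> tensor_power scl n" "Y \<in> tensor_power scl n"
  shows "tensor_lift sc F (tensor_add scl n X Y) = tensor_lift sc F X + tensor_lift sc F Y"
proof -
  interpret V: vector_space sc by fact
  show ?thesis
    using assms by (simp add: tensor_add_def tensor_lift_class free_space_add tensor_power_rep
        V.lin_ext_add) (simp add: tensor_lift_def)
qed

lemma tensor_lift_scale_tensor:
  assumes "vector_space sc" "multilinear scl sc n F" "X \<in> tensor_power scl n"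
  shows "tensor_lift sc F (tensor_scale scl n c X) = sc c (tensor_lift sc F X)"
proof -
  interpret V: vector_space sc by fact
  show ?thesis
    using assms by (simp add: tensor_scale_def tensor_lift_class free_space_scale tensor_power_rep
        V.lin_ext_free_scale) (simp add: tensor_lift_def)
qed

text \<open>
  The value of \<open>tensor_map\<close> is taken at a chosen representative; it can be computed at any
  representative as soon as the map sends the generating relations to relations.
\<close>

lemma tensor_map_class:
  fixes scl :: "'k::field \<Rightarrow> 'a::ab_group_add \<Rightarrow> 'a"
  assumes "u \<in> free_space n" "\<And>xs. length xs = n \<Longrightarrow> g xs \<in> free_space m"
    and rel: "\<And>r. r \<in> multilinear_relations scl n \<Longrightarrow>
      lin_ext free_scale g r \<in> Modules.module.span free_scale (multilinear_relations scl m)"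
  shows "tensor_map scl m g (tensor_class scl n u) = tensor_class scl m (lin_ext free_scale g u)"
proof -
  interpret U: vector_space "free_scale :: 'k \<Rightarrow> ('a list \<Rightarrow>\<^sub>0 'k) \<Rightarrow> _"
    by (rule vector_space_free_scale)
  have "lin_ext free_scale g r \<in> U.span (multilinear_relations scl m)"
    if "r \<in> U.span (multilinear_relations scl n)" for r
    using that
    by (induction rule: U.span_induct_alt)
       (simp_all add: U.lin_ext_add U.lin_ext_free_scale U.span_zero U.span_add U.span_scale rel)
  from this[OF tensor_rep_class(2)[OF assms(1), of scl]] show ?thesis
    unfolding tensor_map_def U.lin_ext_diff
    by (intro tensor_class_eqI[symmetric] free_space_lin_ext assms(2))
       (auto intro: length_free_space assms(1) tensor_rep_class(1))
qed

section \<open>Sweedler calculus\<close>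

text \<open>
  Sweedler sums with values in a vector space \<open>V\<close>.  Every axiom of a Hopf algebra becomes an identity
  between such sums, valid for all multilinear integrands, and this is the form in which all later
  computations use them.
\<close>

locale hopf_coefficients = hopf_algebra scl \<Delta> \<epsilon> S + V: vector_space sc
  for scl :: "'k::field \<Rightarrow> 'a::ring_1 \<Rightarrow> 'a" and \<Delta> :: "'a \<Rightarrow> ('a, 'k) tensor"
    and \<epsilon> :: "'a \<Rightarrow> 'k" and S :: "'a \<Rightarrow> 'a"
    and sc :: "'k \<Rightarrow> 'v::ab_group_add \<Rightarrow> 'v"
begin

abbreviation lin :: "('a \<Rightarrow> 'v) \<Rightarrow> bool"
  where "lin \<equiv> Vector_Spaces.linear scl sc"

definition bilin :: "('a \<Rightarrow> 'a \<Rightarrow> 'v) \<Rightarrow> bool"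
  where "bilin B \<longleftrightarrow> (\<forall>y. lin (\<lambda>x. B x y)) \<and> (\<forall>x. lin (B x))"

definition trilin :: "('a \<Rightarrow> 'a \<Rightarrow> 'a \<Rightarrow> 'v) \<Rightarrow> bool"
  where "trilin T \<longleftrightarrow> (\<forall>y z. lin (\<lambda>x. T x y z)) \<and> (\<forall>x. bilin (T x))"

lemma lin_iff: "lin g \<longleftrightarrow> (\<forall>x y. g (x + y) = g x + g y) \<and> (\<forall>c x. g (scl c x) = sc c (g x))"
  using vector_space_axioms V.vector_space_axioms by (simp add: Vector_Spaces.linear_iff)

lemma eps_add [simp]: "\<epsilon> (x + y) = \<epsilon> x + \<epsilon> y" and eps_scl [simp]: "\<epsilon> (scl c x) = c * \<epsilon> x"
  using counit_linear by (simp_all add: Vector_Spaces.linear_iff)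

lemma S_add [simp]: "S (x + y) = S x + S y" and S_scl [simp]: "S (scl c x) = scl c (S x)"
  using antipode_linear by (simp_all add: Vector_Spaces.linear_iff)

lemma scl_mult [simp]: "scl c x * y = scl c (x * y)" "x * scl c y = scl c (x * y)"
  by (rule scl_mult_left scl_mult_right)+

text \<open>
  \<open>sweedler a (\<lambda>x y. B x y)\<close> stands for \<open>\<Sum> B a\<^sup>1 a\<^sup>2\<close>; iterated sums render iterated coproducts.  It is
  a finite sum over one chosen representative of \<open>\<Delta> a\<close>, so it is linear in the integrand for arbitrary
  \<open>B\<close>, whereas linearity in \<open>a\<close> and the Hopf algebra axioms need \<open>B\<close> to be bilinear.
\<close>

definition sweedler :: "'a \<Rightarrow> ('a \<Rightarrow> 'a \<Rightarrow> 'v) \<Rightarrow> 'v"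
  where "sweedler a B = tensor_lift sc (\<lambda>t. B (t ! 0) (t ! 1)) (\<Delta> a)"

lemma sweedler_eq_sum:
  "sweedler a B = (\<Sum>t\<in>Poly_Mapping.keys (tensor_rep (\<Delta> a)).
     sc (Poly_Mapping.lookup (tensor_rep (\<Delta> a)) t) (B (t ! 0) (t ! 1)))"
  by (simp add: sweedler_def tensor_lift_def lin_ext_def)

lemma sweedler_add: "sweedler a (\<lambda>x y. B x y + C x y) = sweedler a B + sweedler a C"
  by (simp add: sweedler_eq_sum V.scale_right_distrib sum.distrib)

lemma sweedler_scale: "sweedler a (\<lambda>x y. sc c (B x y)) = sc c (sweedler a B)"
  by (simp add: sweedler_eq_sum V.scale_sum_right mult.commute)

lemma sweedler_exchange:
  "sweedler a (\<lambda>x y. sweedler b (\<lambda>u v. B x y u v)) = sweedler b (\<lambda>u v. sweedler a (\<lambda>x y. B x y u v))"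
  unfolding sweedler_eq_sum V.scale_sum_right
  by (subst sum.swap) (simp add: mult.commute)

lemma multilinear_2: "bilin B \<Longrightarrow> multilinear scl sc 2 (\<lambda>t. B (t ! 0) (t ! 1))"
  by (auto simp: numeral_2_eq_2 multilinear_Suc multilinear_0 bilin_def length_Suc_conv)

lemma multilinear_3: "trilin T \<Longrightarrow> multilinear scl sc 3 (\<lambda>t. T (t ! 0) (t ! 1) (t ! 2))"
  by (auto simp: numeral_3_eq_3 numeral_2_eq_2 multilinear_Suc multilinear_0 bilin_def trilin_def length_Suc_conv)

lemma sweedler_arg_add: "bilin B \<Longrightarrow> sweedler (a + b) B = sweedler a B + sweedler b B"
  unfolding sweedler_def comult_add
  by (intro tensor_lift_add_tensor V.vector_space_axioms multilinear_2 comult_closed)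

lemma sweedler_arg_scl: "bilin B \<Longrightarrow> sweedler (scl c a) B = sc c (sweedler a B)"
  unfolding sweedler_def comult_scl
  by (intro tensor_lift_scale_tensor V.vector_space_axioms multilinear_2 comult_closed)

lemma tensor_lift_comult_left:
  assumes "trilin T"
  shows "tensor_lift sc (\<lambda>t. T (t ! 0) (t ! 1) (t ! 2)) (comult_left scl \<Delta> (\<Delta> a))
    = sweedler a (\<lambda>x y. sweedler x (\<lambda>u v. T u v y))"
proof -
  have rep: "tensor_rep (\<Delta> x) \<in> free_space 2" for x
    by (rule tensor_power_rep(1)[OF comult_closed])
  have cat: "free_cat (tensor_rep (\<Delta> x)) (Poly_Mapping.single [y] 1) \<in> free_space 3" for x y
    unfolding free_cat_def
    by (intro free_space_lin_ext free_space_single)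
       (use rep[of x] in \<open>auto simp: length_free_space split: if_splits\<close>)
  have "lin_ext sc (\<lambda>t. T (t ! 0) (t ! 1) (t ! 2))
          (free_cat (tensor_rep (\<Delta> x)) (Poly_Mapping.single [y] 1))
      = sweedler x (\<lambda>u v. T u v y)" for x y
    unfolding free_cat_def V.lin_ext_lin_ext sweedler_def tensor_lift_def
    by (rule lin_ext_cong) (use length_free_space[OF rep[of x]] in \<open>simp add: nth_append\<close>)
  then show ?thesis
    unfolding comult_left_def
    by (subst tensor_lift_map[OF V.vector_space_axioms multilinear_3[OF assms] comult_closed])
       (simp_all add: cat sweedler_def[of a])
qed

lemma tensor_lift_comult_right:
  assumes "trilin T"
  shows "tensor_lift sc (\<lambda>t. T (t ! 0) (t ! 1) (t ! 2)) (comult_right scl \<Delta> (\<Delta> a))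
    = sweedler a (\<lambda>x y. sweedler y (\<lambda>u v. T x u v))"
proof -
  have rep: "tensor_rep (\<Delta> x) \<in> free_space 2" for x
    by (rule tensor_power_rep(1)[OF comult_closed])
  have cat: "free_cat (Poly_Mapping.single [x] 1) (tensor_rep (\<Delta> y)) \<in> free_space 3" for x y
    unfolding free_cat_def
    by (intro free_space_lin_ext free_space_single)
       (use rep[of y] in \<open>auto simp: length_free_space split: if_splits\<close>)
  have "lin_ext sc (\<lambda>t. T (t ! 0) (t ! 1) (t ! 2))
          (free_cat (Poly_Mapping.single [x] 1) (tensor_rep (\<Delta> y)))
      = sweedler y (\<lambda>u v. T x u v)" for x y
    by (simp add: free_cat_def V.lin_ext_lin_ext sweedler_def tensor_lift_def)
  then show ?thesis
    unfolding comult_right_def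
    by (subst tensor_lift_map[OF V.vector_space_axioms multilinear_3[OF assms] comult_closed])
       (simp_all add: cat sweedler_def[of a])
qed

lemma sweedler_coassoc:
  assumes "trilin T"
  shows "sweedler a (\<lambda>x y. sweedler x (\<lambda>u v. T u v y)) = sweedler a (\<lambda>x y. sweedler y (\<lambda>u v. T x u v))"
  using tensor_lift_comult_left[OF assms, of a] tensor_lift_comult_right[OF assms, of a]
  by (simp add: coassoc)

lemma sweedler_mult:
  assumes "bilin B"
  shows "sweedler (a * b) B = sweedler a (\<lambda>x y. sweedler b (\<lambda>u v. B (x * u) (y * v)))"
proof -
  have rep: "tensor_rep (\<Delta> x) \<in> free_space 2" for x
    by (rule tensor_power_rep(1)[OF comult_closed])
  have fs: "lin_ext free_scale (\<lambda>ys. Poly_Mapping.single (map2 (*) xs ys) 1) (tensor_rep (\<Delta> b)) \<in> free_space 2"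
    if "length xs = 2" for xs
    by (intro free_space_lin_ext free_space_single) (simp add: that length_free_space[OF rep])
  have "lin_ext sc (\<lambda>t. B (t ! 0) (t ! 1))
          (lin_ext free_scale (\<lambda>ys. Poly_Mapping.single (map2 (*) xs ys) 1) (tensor_rep (\<Delta> b)))
      = sweedler b (\<lambda>u v. B (xs ! 0 * u) (xs ! 1 * v))" if "length xs = 2" for xs
    unfolding V.lin_ext_lin_ext sweedler_def tensor_lift_def
    by (rule lin_ext_cong) (use that length_free_space[OF rep[of b]] in simp)
  then show ?thesis
    unfolding sweedler_def[of "a * b"] comult_mult tensor_mult_def
    by (subst tensor_lift_map[OF V.vector_space_axioms multilinear_2[OF assms] comult_closed fs])
       (auto simp: sweedler_def[of a] intro!: tensor_lift_cong[OF comult_closed])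
qed

lemma lin_tensor_lift: "lin g \<Longrightarrow> g (tensor_lift scl h X) = tensor_lift sc (\<lambda>t. g (h t)) X"
  by (simp add: tensor_lift_def linear_lin_ext)

lemma sweedler_counit_left:
  assumes "lin g" shows "sweedler a (\<lambda>x y. sc (\<epsilon> x) (g y)) = g a"
  using lin_tensor_lift[OF assms, of "\<lambda>t. scl (\<epsilon> (t ! 0)) (t ! 1)" "\<Delta> a"]
  by (simp add: counit_left sweedler_def linear_homogeneous[OF assms] del: One_nat_def)

lemma sweedler_counit_right:
  assumes "lin g" shows "sweedler a (\<lambda>x y. sc (\<epsilon> y) (g x)) = g a"
  using lin_tensor_lift[OF assms, of "\<lambda>t. scl (\<epsilon> (t ! 1)) (t ! 0)" "\<Delta> a"]
  by (simp add: counit_right sweedler_def linear_homogeneous[OF assms] del: One_nat_def)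

lemma sweedler_antipode_left:
  assumes "lin g" shows "sweedler a (\<lambda>x y. g (S x * y)) = sc (\<epsilon> a) (g 1)"
  using lin_tensor_lift[OF assms, of "\<lambda>t. S (t ! 0) * t ! 1" "\<Delta> a"]
  by (simp add: antipode_left sweedler_def linear_homogeneous[OF assms] del: One_nat_def)

lemma sweedler_antipode_right:
  assumes "lin g" shows "sweedler a (\<lambda>x y. g (x * S y)) = sc (\<epsilon> a) (g 1)"
  using lin_tensor_lift[OF assms, of "\<lambda>t. t ! 0 * S (t ! 1)" "\<Delta> a"]
  by (simp add: antipode_right sweedler_def linear_homogeneous[OF assms] del: One_nat_def)

text \<open>
  By coassociativity the antipode axiom applies to the last two of three factors, and the counit it
  leaves is absorbed: \<open>\<Sum> x\<^sup>1 \<otimes> S x\<^sup>2 x\<^sup>3 = \<Sum> x\<^sup>1 \<otimes> \<epsilon> x\<^sup>2 = x \<otimes> 1\<close>.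
\<close>

lemma sweedler_antipode_left_counit:
  assumes "bilin K"
  shows "sweedler x (\<lambda>u v. sweedler u (\<lambda>p q. K p (S q * v))) = K x 1"
proof -
  have "trilin (\<lambda>p q v. K p (S q * v))"
    using assms by (auto simp: trilin_def bilin_def lin_iff algebra_simps)
  from sweedler_coassoc[OF this]
  have "sweedler x (\<lambda>u v. sweedler u (\<lambda>p q. K p (S q * v))) = sweedler x (\<lambda>p v. sweedler v (\<lambda>q v. K p (S q * v)))" .
  also have "\<dots> = sweedler x (\<lambda>p v. sc (\<epsilon> v) (K p 1))"
    using assms by (simp add: bilin_def sweedler_antipode_left)
  also have "\<dots> = K x 1"
    using assms by (intro sweedler_counit_right) (simp add: bilin_def)
  finally show ?thesis .
qed

lemma sweedler_antipode_right_counit: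
  assumes "bilin K"
  shows "sweedler x (\<lambda>u v. sweedler u (\<lambda>p q. K p (q * S v))) = K x 1"
proof -
  have "trilin (\<lambda>p q v. K p (q * S v))"
    using assms by (auto simp: trilin_def bilin_def lin_iff algebra_simps)
  from sweedler_coassoc[OF this]
  have "sweedler x (\<lambda>u v. sweedler u (\<lambda>p q. K p (q * S v))) = sweedler x (\<lambda>p v. sweedler v (\<lambda>q v. K p (q * S v)))" .
  also have "\<dots> = sweedler x (\<lambda>p v. sc (\<epsilon> v) (K p 1))"
    using assms by (simp add: bilin_def sweedler_antipode_right)
  also have "\<dots> = K x 1"
    using assms by (intro sweedler_counit_right) (simp add: bilin_def)
  finally show ?thesis .
qed

lemma sweedler_merge_left:
  assumes "bilin K"
  shows "sweedler b (\<lambda>b1 b2. sweedler b1 (\<lambda>c1 c2. K (c1 * S c2) b2)) = K 1 b"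
proof -
  have "lin (\<lambda>x. K x y)" for y
    using assms by (simp add: bilin_def)
  from sweedler_antipode_right[OF this]
  have "sweedler b (\<lambda>b1 b2. sweedler b1 (\<lambda>c1 c2. K (c1 * S c2) b2)) = sweedler b (\<lambda>x y. sc (\<epsilon> x) (K 1 y))"
    by simp
  also have "\<dots> = K 1 b"
    using assms by (intro sweedler_counit_left) (simp add: bilin_def)
  finally show ?thesis .
qed

text \<open>
  Insert \<open>b\<^sup>2 S b\<^sup>3\<close> behind \<open>a\<^sup>2\<close> and apply the antipode axiom to the product \<open>a b\<^sup>1\<close>:
  \<open>\<Sum> S (a\<^sup>1 b) a\<^sup>2 = \<Sum> S (a\<^sup>1 b\<^sup>1) a\<^sup>2 b\<^sup>2 S b\<^sup>3 = \<epsilon> a S b\<close>.  This takes the place of the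
  anti-multiplicativity of the antipode.
\<close>

lemma sweedler_antipode_mult_cancel:
  assumes "lin g"
  shows "sweedler a (\<lambda>x y. g (S (x * b) * y)) = sc (\<epsilon> a) (g (S b))"
proof -
  \<comment> \<open>The middle term \<open>\<Sum> S (a\<^sup>1 p) a\<^sup>2 q\<close>; it is used for \<open>p = b\<^sup>1\<close> and \<open>q = b\<^sup>2 S b\<^sup>3\<close>.\<close>
  let ?K = "\<lambda>p q. sweedler a (\<lambda>x y. g (S (x * p) * (y * q)))"
  have bil: "bilin ?K"
    using assms by (auto simp: bilin_def lin_iff algebra_simps sweedler_add sweedler_scale)
  have "bilin (\<lambda>p q. g (S p * q * c))" for c
    using assms by (auto simp: bilin_def lin_iff algebra_simps)
  then have mult: "sweedler (a * u) (\<lambda>p q. g (S p * q * c))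
      = sweedler a (\<lambda>x y. sweedler u (\<lambda>p q. g (S (x * p) * (y * q) * c)))" for u c
    by (rule sweedler_mult)
  have "sweedler a (\<lambda>x y. g (S (x * b) * y)) = ?K b 1" by simp
  also have "\<dots> = sweedler b (\<lambda>u v. sweedler u (\<lambda>p q. ?K p (q * S v)))"
    using sweedler_antipode_right_counit[OF bil] by simp
  also have "\<dots> = sweedler b (\<lambda>u v. sweedler (a * u) (\<lambda>p q. g (S p * q * S v)))"
    unfolding mult by (simp add: sweedler_exchange[of _ a] mult.assoc)
  also have "\<dots> = sweedler b (\<lambda>u v. sc (\<epsilon> u) (sc (\<epsilon> a) (g (S v))))"
  proof -
    have "lin (\<lambda>w. g (w * S v))" for v
      using assms by (auto simp: lin_iff algebra_simps)
    from sweedler_antipode_left[OF this] show ?thesis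
      by (simp add: counit_mult mult.commute)
  qed
  also have "\<dots> = sc (\<epsilon> a) (g (S b))"
    using assms by (intro sweedler_counit_left) (auto simp: lin_iff V.scale_right_distrib mult.commute)
  finally show ?thesis .
qed

end

locale cocommutative_hopf_coefficients = hopf_coefficients scl \<Delta> \<epsilon> S sc + cocommutative_hopf_algebra scl \<Delta> \<epsilon> S
  for scl :: "'k::field \<Rightarrow> 'a::ring_1 \<Rightarrow> 'a" and \<Delta> :: "'a \<Rightarrow> ('a, 'k) tensor"
    and \<epsilon> :: "'a \<Rightarrow> 'k" and S :: "'a \<Rightarrow> 'a"
    and sc :: "'k \<Rightarrow> 'v::ab_group_add \<Rightarrow> 'v"
begin

lemma sweedler_cocommutative:
  assumes "bilin B"
  shows "sweedler a (\<lambda>x y. B y x) = sweedler a B"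
proof -
  have "sweedler a B = tensor_lift sc (\<lambda>t. B (t ! 0) (t ! 1))
      (tensor_map scl 2 (\<lambda>t. Poly_Mapping.single [t ! 1, t ! 0] 1) (\<Delta> a))"
    using cocommutative[of a] by (simp add: sweedler_def del: One_nat_def)
  also have "\<dots> = sweedler a (\<lambda>x y. B y x)"
    by (subst tensor_lift_map[OF V.vector_space_axioms multilinear_2[OF assms] comult_closed])
       (simp_all add: sweedler_def free_space_single)
  finally show ?thesis ..
qed

text \<open>
  The computation that explains the formulas for \<open>\<sigma>\<^sub>i\<close>.  Start from \<open>a \<otimes> b \<otimes> c\<close>, pass to homogeneous
  coordinates \<open>a\<^sup>1 \<otimes> a\<^sup>2 b\<^sup>1 \<otimes> a\<^sup>3 b\<^sup>2 c\<close>, exchange the first two factors, and return: writing \<open>x\<close> and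
  \<open>y\<close> for these two factors, the result is built from \<open>y\<^sup>1\<close>, \<open>S y\<^sup>2 x\<^sup>1\<close> and \<open>S x\<^sup>2\<close> times the third
  factor.  Cocommutativity brings \<open>S x\<^sup>2\<close> next to the factor of \<open>a\<close> that cancels it, and then again
  the two remaining factors of \<open>a\<close> into the order of the identity \<open>\<Sum> S (a\<^sup>1 b) a\<^sup>2 = \<epsilon> a S b\<close>.  What
  remains is \<open>a b\<^sup>1 \<otimes> S b\<^sup>2 \<otimes> b\<^sup>3 c\<close>.  The factor \<open>c\<close> enters through the last argument of \<open>L\<close>.
\<close>

lemma sweedler_conjugated_swap:
  assumes "trilin L"
  shows "sweedler a (\<lambda>a1 a2. sweedler (a2 * b) (\<lambda>y1 y2. sweedler a1 (\<lambda>x1 x2.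
           sweedler y1 (\<lambda>u1 u2. L u1 (S u2 * x1) (S x2 * y2)))))
       = sweedler b (\<lambda>b1 b2. sweedler b1 (\<lambda>c1 c2. L (a * c1) (S c2) b2))"
proof -
  have L [simp]:
    "L (x + x') y z = L x y z + L x' y z" "L x (y + y') z = L x y z + L x y' z"
    "L x y (z + z') = L x y z + L x y z'" "L (scl c x) y z = sc c (L x y z)"
    "L x (scl c y) z = sc c (L x y z)" "L x y (scl c z) = sc c (L x y z)" for x x' y y' z z' c
    using assms by (simp_all add: trilin_def bilin_def lin_iff)
  note dist = distrib_left distrib_right sweedler_add sweedler_scale V.scale_right_distrib
  define M where "M q x r = sweedler q (\<lambda>u1 u2. L u1 (S u2 * x) r)" for q x r
  have bil: "bilin (\<lambda>u1 u2. L u1 (S u2 * x) r)" for x r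
    by (simp add: bilin_def lin_iff dist)
  have M [simp]:
    "M (x + x') y z = M x y z + M x' y z" "M x (y + y') z = M x y z + M x y' z"
    "M x y (z + z') = M x y z + M x y z'" "M (scl c x) y z = sc c (M x y z)"
    "M x (scl c y) z = sc c (M x y z)" "M x y (scl c z) = sc c (M x y z)" for x x' y y' z z' c
    by (simp_all add: M_def sweedler_arg_add[OF bil] sweedler_arg_scl[OF bil] dist)
  define K where "K p x r = sweedler b (\<lambda>b1 b2. M (p * b1) x (r * b2))" for p x r
  have bilK: "bilin (K p)" for p
    by (simp add: K_def bilin_def lin_iff dist)
  have bilK': "bilin (\<lambda>x p. K p x r)" for r
    by (simp add: K_def bilin_def lin_iff dist)
  have bilKS: "bilin (\<lambda>x y. K p x (S y * r))" for p r
    by (simp add: K_def bilin_def lin_iff dist)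
  \<comment> \<open>Comultiply the product \<open>a2 * b\<close>; now \<open>a\<close> has four factors, in the order \<open>x1, x2, p1, p2\<close>.\<close>
  have "sweedler a (\<lambda>a1 a2. sweedler (a2 * b) (\<lambda>y1 y2. sweedler a1 (\<lambda>x1 x2. M y1 x1 (S x2 * y2))))
      = sweedler a (\<lambda>a1 a2. sweedler a2 (\<lambda>p1 p2. sweedler a1 (\<lambda>x1 x2. K p1 x1 (S x2 * p2))))"
  proof -
    have "bilin (\<lambda>y1 y2. sweedler a1 (\<lambda>x1 x2. M y1 x1 (S x2 * y2)))" for a1
      by (simp add: bilin_def lin_iff dist)
    from sweedler_mult[OF this] show ?thesis
      by (simp add: K_def sweedler_exchange[of _ b] mult.assoc)
  qed
  \<comment> \<open>Cocommutativity exchanges \<open>p1\<close> and \<open>p2\<close>, so that \<open>S x2\<close> stands next to \<open>p2\<close>.\<close>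
  also have "\<dots> = sweedler a (\<lambda>a1 a2. sweedler a2 (\<lambda>p2 p1. sweedler a1 (\<lambda>x1 x2. K p1 x1 (S x2 * p2))))"
  proof -
    have "bilin (\<lambda>p1 p2. sweedler a1 (\<lambda>x1 x2. K p1 x1 (S x2 * p2)))" for a1
      by (simp add: K_def bilin_def lin_iff dist)
    from sweedler_cocommutative[OF this] show ?thesis by simp
  qed
  also have "\<dots> = sweedler a (\<lambda>z p1. sweedler z (\<lambda>a1 p2. sweedler a1 (\<lambda>x1 x2. K p1 x1 (S x2 * p2))))"
  proof -
    have "trilin (\<lambda>a1 p2 p1. sweedler a1 (\<lambda>x1 x2. K p1 x1 (S x2 * p2)))"
      unfolding trilin_def bilin_def lin_iff sweedler_arg_add[OF bilKS] sweedler_arg_scl[OF bilKS]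
      by (simp add: K_def dist)
    from sweedler_coassoc[OF this] show ?thesis by simp
  qed
  \<comment> \<open>Cancel \<open>S x2 * p2\<close>, and exchange the two factors of \<open>a\<close> that are left.\<close>
  also have "\<dots> = sweedler a (\<lambda>p z. K p z 1)"
    by (simp add: sweedler_antipode_left_counit[OF bilK] sweedler_cocommutative[OF bilK'])
  also have "\<dots> = sweedler a (\<lambda>p z. sweedler p (\<lambda>p1 p2. sweedler b (\<lambda>b1 b2.
      sweedler b1 (\<lambda>c1 c2. L (p1 * c1) (S (p2 * c2) * z) b2))))"
    by (simp add: K_def M_def sweedler_mult[OF bil] sweedler_exchange[of _ b])
  also have "\<dots> = sweedler a (\<lambda>p1 w. sweedler w (\<lambda>p2 z. sweedler b (\<lambda>b1 b2.
      sweedler b1 (\<lambda>c1 c2. L (p1 * c1) (S (p2 * c2) * z) b2))))"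
    by (rule sweedler_coassoc) (simp add: trilin_def bilin_def lin_iff dist)
  also have "\<dots> = sweedler a (\<lambda>p1 w. sweedler b (\<lambda>b1 b2.
      sweedler b1 (\<lambda>c1 c2. sweedler w (\<lambda>p2 z. L (p1 * c1) (S (p2 * c2) * z) b2))))"
    by (simp add: sweedler_exchange[of _ b]) (subst sweedler_exchange, rule refl)
  \<comment> \<open>Here \<open>\<Sum> S (p2 c2) z = \<epsilon> w S c2\<close> for the coproduct \<open>\<Sum> p2 \<otimes> z\<close> of \<open>w\<close>.\<close>
  also have "\<dots> = sweedler a (\<lambda>p1 w. sc (\<epsilon> w) (sweedler b (\<lambda>b1 b2.
      sweedler b1 (\<lambda>c1 c2. L (p1 * c1) (S c2) b2))))"
  proof -
    have "lin (\<lambda>y. L x y z)" for x z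
      by (simp add: lin_iff)
    from sweedler_antipode_mult_cancel[OF this] show ?thesis
      by (simp add: sweedler_scale)
  qed
  also have "\<dots> = sweedler b (\<lambda>b1 b2. sweedler b1 (\<lambda>c1 c2. L (a * c1) (S c2) b2))"
    by (rule sweedler_counit_right) (simp add: lin_iff dist)
  finally show ?thesis
    by (simp add: M_def)
qed

end

section \<open>Operators on multilinear functions\<close>

context hopf_coefficients
begin

text \<open>
  The transpose of left multiplication by \<open>b\<close> on the first factor of a tensor power, where the
  tensor power of order \<open>0\<close> is the trivial module \<open>k\<close>.  The convention on the empty list makes the formula for
  \<open>\<sigma>\<^sub>n\<close> and the last term of the differential instances of the general ones.
\<close>

definition act_head :: "'a \<Rightarrow> ('a list \<Rightarrow> 'v) \<Rightarrow> 'a list \<Rightarrow> 'v"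
  where "act_head b G xs = (case xs of [] \<Rightarrow> sc (\<epsilon> b) (G []) | x # xs' \<Rightarrow> G (b * x # xs'))"

lemma act_head_simps [simp]:
  "act_head b G [] = sc (\<epsilon> b) (G [])" "act_head b G (x # xs) = G (b * x # xs)"
  by (simp_all add: act_head_def)

lemma act_head_one [simp]: "act_head 1 G = G"
  by (rule ext) (simp add: act_head_def counit_one split: list.split)

lemma act_head_act_head [simp]: "act_head b (act_head c G) = act_head (c * b) G"
  by (rule ext) (simp add: act_head_def counit_mult mult.assoc mult.commute[of "\<epsilon> b"] split: list.split)

lemma act_head_add: "act_head b (\<lambda>ys. F ys + G ys) xs = act_head b F xs + act_head b G xs"
  by (cases xs) (simp_all add: V.scale_right_distrib)

lemma act_head_scale: "act_head b (\<lambda>ys. sc c (F ys)) xs = sc c (act_head b F xs)"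
  by (cases xs) (simp_all add: mult.commute)

lemma act_head_sweedler: "act_head b (\<lambda>ys. sweedler a (\<lambda>u v. F u v ys)) xs = sweedler a (\<lambda>u v. act_head b (F u v) xs)"
  by (cases xs) (simp_all add: sweedler_scale)

abbreviation multilin :: "nat \<Rightarrow> ('a list \<Rightarrow> 'v) \<Rightarrow> bool"
  where "multilin \<equiv> multilinear scl sc"

lemma lin_act_head: "multilin (length xs) G \<Longrightarrow> lin (\<lambda>b. act_head b G xs)"
  by (cases xs) (auto simp: multilinear_Suc lin_iff V.scale_left_distrib distrib_right)

lemma multilin_act_head: "multilin n G \<Longrightarrow> multilin n (act_head b G)"
proof (cases n)
  case (Suc m)
  assume "multilin n G"
  then show ?thesis
    by (auto simp: Suc multilinear_Suc lin_iff distrib_left)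
qed (simp add: multilinear_0)

lemma multilin_add: "multilin n F \<Longrightarrow> multilin n G \<Longrightarrow> multilin n (\<lambda>xs. F xs + G xs)"
  by (auto simp: multilinear_def lin_iff V.scale_right_distrib algebra_simps)

lemma multilin_scale: "multilin n F \<Longrightarrow> multilin n (\<lambda>xs. sc c (F xs))"
  by (auto simp: multilinear_def lin_iff V.scale_right_distrib mult.commute)

lemma multilin_sum: "(\<And>i. i \<in> I \<Longrightarrow> multilin n (F i)) \<Longrightarrow> multilin n (\<lambda>xs. \<Sum>i\<in>I. F i xs)"
proof (induction I rule: infinite_finite_induct)
  case empty show ?case by (auto simp: multilinear_def lin_iff)
next
  case (infinite I) then show ?case by (auto simp: multilinear_def lin_iff)
qed (simp add: multilin_add)

lemma multilin_sweedler:
  "(\<And>u v. multilin n (F u v)) \<Longrightarrow> multilin n (\<lambda>xs. sweedler a (\<lambda>u v. F u v xs))"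
  by (auto simp: multilinear_def lin_iff sweedler_add sweedler_scale)

text \<open>
  The operators below are the transposes of linear maps \<open>A\<^sup>\<otimes>\<^sup>m \<rightarrow> A\<^sup>\<otimes>\<^sup>n\<close>, so they compose in the reverse
  order of these maps.  Functions on lists are only meaningful on one length; the first clause makes
  an operator independent of the values on other lengths.
\<close>

definition operator :: "nat \<Rightarrow> nat \<Rightarrow> (('a list \<Rightarrow> 'v) \<Rightarrow> 'a list \<Rightarrow> 'v) \<Rightarrow> bool"
  where "operator n m T \<longleftrightarrow>
    (\<forall>F G xs. (\<forall>ys. length ys = n \<longrightarrow> F ys = G ys) \<longrightarrow> length xs = m \<longrightarrow> T F xs = T G xs) \<and>
    (\<forall>F G xs. length xs = m \<longrightarrow> T (\<lambda>ys. F ys + G ys) xs = T F xs + T G xs) \<and>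
    (\<forall>c F xs. length xs = m \<longrightarrow> T (\<lambda>ys. sc c (F ys)) xs = sc c (T F xs)) \<and>
    (\<forall>F. multilin n F \<longrightarrow> multilin m (T F))"

lemma operator_cong:
  assumes "operator n m T" "\<And>ys. length ys = n \<Longrightarrow> F ys = G ys" "length xs = m"
  shows "T F xs = T G xs"
  using assms by (simp add: operator_def)

lemma operator_add: "operator n m T \<Longrightarrow> length xs = m \<Longrightarrow> T (\<lambda>ys. F ys + G ys) xs = T F xs + T G xs"
  and operator_scale: "operator n m T \<Longrightarrow> length xs = m \<Longrightarrow> T (\<lambda>ys. sc c (F ys)) xs = sc c (T F xs)"
  and operator_multilin: "operator n m T \<Longrightarrow> multilin n F \<Longrightarrow> multilin m (T F)"
  by (simp_all add: operator_def)

lemma operator_sum: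
  assumes "operator n m T" "length xs = m"
  shows "T (\<lambda>ys. \<Sum>i\<in>I. F i ys) xs = (\<Sum>i\<in>I. T (F i) xs)"
proof -
  have "T (\<lambda>ys. 0) xs = 0"
    using operator_scale[OF assms, of 0] by simp
  then show ?thesis
    by (induction I rule: infinite_finite_induct) (simp_all add: operator_add[OF assms])
qed

lemma operator_sweedler:
  assumes "operator n m T" "length xs = m"
  shows "T (\<lambda>ys. sweedler a (\<lambda>u v. F u v ys)) xs = sweedler a (\<lambda>u v. T (F u v) xs)"
  by (simp add: sweedler_eq_sum operator_sum[OF assms] operator_scale[OF assms])

lemma operator_id: "operator n n (\<lambda>F. F)"
  by (simp add: operator_def)

lemma operator_comp:
  assumes "operator n m T" "operator m k U"
  shows "operator n k (\<lambda>F. U (T F))"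
  unfolding operator_def
proof (intro conjI allI impI)
  fix F G :: "'a list \<Rightarrow> 'v" and xs :: "'a list"
  assume xs: "length xs = k"
  show "U (T F) xs = U (T G) xs" if "\<forall>ys. length ys = n \<longrightarrow> F ys = G ys"
    using that by (intro operator_cong[OF assms(2) operator_cong[OF assms(1)] xs]) auto
  have "U (T (\<lambda>ys. F ys + G ys)) xs = U (\<lambda>ys. T F ys + T G ys) xs"
    by (intro operator_cong[OF assms(2) _ xs] operator_add[OF assms(1)])
  then show "U (T (\<lambda>ys. F ys + G ys)) xs = U (T F) xs + U (T G) xs"
    by (simp add: operator_add[OF assms(2) xs])
next
  fix c and F :: "'a list \<Rightarrow> 'v" and xs :: "'a list"
  assume xs: "length xs = k"
  have "U (T (\<lambda>ys. sc c (F ys))) xs = U (\<lambda>ys. sc c (T F ys)) xs"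
    by (intro operator_cong[OF assms(2) _ xs] operator_scale[OF assms(1)])
  then show "U (T (\<lambda>ys. sc c (F ys))) xs = sc c (U (T F) xs)"
    by (simp add: operator_scale[OF assms(2) xs])
qed (intro operator_multilin[OF assms(2)] operator_multilin[OF assms(1)])

text \<open>
  The transpose of \<open>id \<otimes> t\<close>, where \<open>T\<close> is the transpose of \<open>t\<close>.  The maps in question are built from
  maps near the head of the list by repeated use of \<open>behind\<close>, so that positions need no indices.
\<close>

definition behind :: "(('a list \<Rightarrow> 'v) \<Rightarrow> 'a list \<Rightarrow> 'v) \<Rightarrow> ('a list \<Rightarrow> 'v) \<Rightarrow> 'a list \<Rightarrow> 'v"
  where "behind T F xs = T (\<lambda>ys. F (hd xs # ys)) (tl xs)"

lemma behind_Cons [simp]: "behind T F (x # xs) = T (\<lambda>ys. F (x # ys)) xs"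
  by (simp add: behind_def)

lemma behind_behind: "behind T (behind U F) = behind (\<lambda>G. T (U G)) F"
  by (rule ext) (simp add: behind_def)

lemma behind_cong:
  assumes "\<And>G ys. multilin n G \<Longrightarrow> length ys = m \<Longrightarrow> T G ys = U G ys"
    and "multilin (Suc n) F" "length xs = Suc m"
  shows "behind T F xs = behind U F xs"
  using assms by (auto simp: length_Suc_conv multilinear_Suc)

lemma operator_behind:
  assumes "operator n m T"
  shows "operator (Suc n) (Suc m) (behind T)"
  unfolding operator_def
proof (intro conjI allI impI)
  fix F G :: "'a list \<Rightarrow> 'v" and xs :: "'a list"
  assume xs: "length xs = Suc m"
  show "behind T F xs = behind T G xs" if "\<forall>ys. length ys = Suc n \<longrightarrow> F ys = G ys"
    unfolding behind_def by (intro operator_cong[OF assms]) (use xs that in auto)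
  show "behind T (\<lambda>ys. F ys + G ys) xs = behind T F xs + behind T G xs"
    unfolding behind_def by (intro operator_add[OF assms]) (use xs in auto)
next
  fix c and F :: "'a list \<Rightarrow> 'v" and xs :: "'a list"
  assume xs: "length xs = Suc m"
  show "behind T (\<lambda>ys. sc c (F ys)) xs = sc c (behind T F xs)"
    unfolding behind_def by (intro operator_scale[OF assms]) (use xs in auto)
next
  fix F :: "'a list \<Rightarrow> 'v"
  assume F: "multilin (Suc n) F"
  show "multilin (Suc m) (behind T F)"
    unfolding multilinear_Suc
  proof (intro conjI allI impI)
    fix ys :: "'a list" assume ys: "length ys = m"
    have "T (\<lambda>zs. F ((x + x') # zs)) ys = T (\<lambda>zs. F (x # zs) + F (x' # zs)) ys" for x x'
      using F by (intro operator_cong[OF assms _ ys]) (auto simp: multilinear_Suc lin_iff)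
    moreover have "T (\<lambda>zs. F (scl c x # zs)) ys = T (\<lambda>zs. sc c (F (x # zs))) ys" for c x
      using F by (intro operator_cong[OF assms _ ys]) (auto simp: multilinear_Suc lin_iff)
    ultimately show "lin (\<lambda>x. behind T F (x # ys))"
      by (simp add: lin_iff operator_add[OF assms ys] operator_scale[OF assms ys])
  next
    fix x show "multilin m (\<lambda>ys. behind T F (x # ys))"
      using F operator_multilin[OF assms] by (simp add: multilinear_Suc)
  qed
qed

lemma operator_act_head: "operator n n (act_head b)"
  unfolding operator_def
proof (intro conjI allI impI)
  fix F G :: "'a list \<Rightarrow> 'v" and xs :: "'a list"
  assume "\<forall>ys. length ys = n \<longrightarrow> F ys = G ys" "length xs = n"
  then show "act_head b F xs = act_head b G xs"
    by (cases xs) auto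
qed (simp_all add: act_head_add act_head_scale multilin_act_head)

text \<open>
  The transpose of the shear \<open>x \<otimes> w \<mapsto> x\<^sup>1 \<otimes> g x\<^sup>2 \<cdot> w\<close>.  For \<open>g = S\<close> and for the identity these are
  inverse to each other.
\<close>

definition shear :: "('a \<Rightarrow> 'a) \<Rightarrow> ('a list \<Rightarrow> 'v) \<Rightarrow> 'a list \<Rightarrow> 'v"
  where "shear g F xs = sweedler (hd xs) (\<lambda>u v. act_head (g v) (\<lambda>ys. F (u # ys)) (tl xs))"

lemma shear_Cons [simp]: "shear g F (x # xs) = sweedler x (\<lambda>u v. act_head (g v) (\<lambda>ys. F (u # ys)) xs)"
  by (simp add: shear_def)

lemma bilin_act_head:
  assumes "multilin (Suc (length xs)) F"
  shows "bilin (\<lambda>u v. act_head v (\<lambda>ys. F (u # ys)) xs)"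
  unfolding bilin_def
proof (intro conjI allI)
  show "lin (\<lambda>v. act_head v (\<lambda>ys. F (u # ys)) xs)" for u
    using assms by (intro lin_act_head) (simp add: multilinear_Suc)
  show "lin (\<lambda>u. act_head v (\<lambda>ys. F (u # ys)) xs)" for v
    using assms by (cases xs) (auto simp: lin_iff multilinear_Suc V.scale_right_distrib mult.commute)
qed

lemma operator_shear:
  assumes "Vector_Spaces.linear scl scl g"
  shows "operator (Suc n) (Suc n) (shear g)"
  unfolding operator_def
proof (intro conjI allI impI)
  fix F G :: "'a list \<Rightarrow> 'v" and xs :: "'a list"
  assume xs: "length xs = Suc n"
  show "shear g F xs = shear g G xs" if "\<forall>ys. length ys = Suc n \<longrightarrow> F ys = G ys"
  proof -
    have "act_head b (\<lambda>ys. F (u # ys)) (tl xs) = act_head b (\<lambda>ys. G (u # ys)) (tl xs)" for b u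
      by (rule operator_cong[OF operator_act_head]) (use that xs in auto)
    then show ?thesis by (simp add: shear_def)
  qed
  show "shear g (\<lambda>ys. F ys + G ys) xs = shear g F xs + shear g G xs"
    by (simp add: shear_def act_head_add sweedler_add)
next
  fix c and F :: "'a list \<Rightarrow> 'v" and xs :: "'a list"
  show "shear g (\<lambda>ys. sc c (F ys)) xs = sc c (shear g F xs)"
    by (simp add: shear_def act_head_scale sweedler_scale)
next
  fix F :: "'a list \<Rightarrow> 'v"
  assume F: "multilin (Suc n) F"
  show "multilin (Suc n) (shear g F)"
    unfolding multilinear_Suc
  proof (intro conjI allI impI)
    fix ys :: "'a list" assume "length ys = n"
    with F have "bilin (\<lambda>u v. act_head v (\<lambda>ys. F (u # ys)) ys)"
      by (intro bilin_act_head) simp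
    then have "bilin (\<lambda>u v. act_head (g v) (\<lambda>ys. F (u # ys)) ys)"
      using assms by (simp add: bilin_def lin_iff Vector_Spaces.linear_iff)
    then show "lin (\<lambda>x. shear g F (x # ys))"
      by (simp add: lin_iff sweedler_arg_add sweedler_arg_scl)
  next
    fix x
    have "multilin n (\<lambda>ys. F (u # ys))" for u
      using F by (simp add: multilinear_Suc)
    then show "multilin n (\<lambda>ys. shear g F (x # ys))"
      by (simp add: multilin_sweedler multilin_act_head)
  qed
qed

lemma shear_S_shear_id:
  assumes "multilin (Suc n) F" "length xs = Suc n"
  shows "shear S (shear (\<lambda>x. x) F) xs = F xs" "shear (\<lambda>x. x) (shear S F) xs = F xs"
proof -
  obtain x zs where xs: "xs = x # zs" "length zs = n"
    using assms(2) by (auto simp: length_Suc_conv)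
  have bil: "bilin (\<lambda>u v. act_head v (\<lambda>ys. F (u # ys)) zs)"
    using assms(1) xs(2) by (intro bilin_act_head) simp
  show "shear S (shear (\<lambda>x. x) F) xs = F xs"
    using sweedler_antipode_right_counit[OF bil, of x] by (simp add: xs act_head_sweedler)
  show "shear (\<lambda>x. x) (shear S F) xs = F xs"
    using sweedler_antipode_left_counit[OF bil, of x] by (simp add: xs act_head_sweedler)
qed

section \<open>Homogeneous coordinates\<close>

text \<open>
  If the \<open>h\<^sub>i\<close> are group-like, the coordinates of \<open>h\<^sub>0 \<otimes> \<dots> \<otimes> h\<^sub>n\<close> in the bar construction are
  \<open>h\<^sub>0, h\<^sub>0\<^sup>-\<^sup>1 h\<^sub>1, \<dots>, h\<^sub>n\<^sub>-\<^sub>1\<^sup>-\<^sup>1 h\<^sub>n\<close>, and conversely \<open>h\<^sub>i = a\<^sub>0 \<cdots> a\<^sub>i\<close>.  In general both changes of coordinates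
  are products of shears in consecutive positions; \<open>to_homogeneous n F\<close> is \<open>F\<close> as a function of the
  \<open>h\<^sub>i\<close>, and \<open>of_homogeneous n F\<close> goes back.
\<close>

primrec to_homogeneous :: "nat \<Rightarrow> ('a list \<Rightarrow> 'v) \<Rightarrow> 'a list \<Rightarrow> 'v" where
  "to_homogeneous 0 = (\<lambda>F. F)"
| "to_homogeneous (Suc n) = (\<lambda>F. behind (to_homogeneous n) (shear S F))"

primrec of_homogeneous :: "nat \<Rightarrow> ('a list \<Rightarrow> 'v) \<Rightarrow> 'a list \<Rightarrow> 'v" where
  "of_homogeneous 0 = (\<lambda>F. F)"
| "of_homogeneous (Suc n) = (\<lambda>F. shear (\<lambda>x. x) (behind (of_homogeneous n) F))"

lemma linear_ident: "Vector_Spaces.linear scl scl (\<lambda>x. x)"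
  by (simp add: Vector_Spaces.linear_iff vector_space_axioms)

lemma operator_to_homogeneous: "operator n n (to_homogeneous n)"
  by (induction n) (simp_all add: operator_id operator_comp[OF operator_shear[OF antipode_linear] operator_behind])

lemma operator_of_homogeneous: "operator n n (of_homogeneous n)"
  by (induction n) (simp_all add: operator_id operator_comp[OF operator_behind operator_shear[OF linear_ident]])

lemma to_of_homogeneous:
  "multilin n F \<Longrightarrow> length xs = n \<Longrightarrow> to_homogeneous n (of_homogeneous n F) xs = F xs"
proof (induction n arbitrary: F xs)
  case (Suc n)
  have B: "multilin (Suc n) (behind (of_homogeneous n) F)"
    by (rule operator_multilin[OF operator_behind[OF operator_of_homogeneous] Suc.prems(1)])
  have "to_homogeneous (Suc n) (of_homogeneous (Suc n) F) xs
      = behind (to_homogeneous n) (shear S (shear (\<lambda>x. x) (behind (of_homogeneous n) F))) xs"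
    by simp
  also have "\<dots> = behind (to_homogeneous n) (behind (of_homogeneous n) F) xs"
    by (intro operator_cong[OF operator_behind[OF operator_to_homogeneous] _ Suc.prems(2)]
        shear_S_shear_id(1)[OF B])
  also have "\<dots> = behind (\<lambda>G. G) F xs"
    unfolding behind_behind by (intro behind_cong[OF _ Suc.prems] Suc.IH)
  also have "\<dots> = F xs"
    using Suc.prems by (auto simp: length_Suc_conv)
  finally show ?case .
qed simp

lemma of_to_homogeneous:
  "multilin n F \<Longrightarrow> length xs = n \<Longrightarrow> of_homogeneous n (to_homogeneous n F) xs = F xs"
proof (induction n arbitrary: F xs)
  case (Suc n)
  have S: "multilin (Suc n) (shear S F)"
    by (rule operator_multilin[OF operator_shear[OF antipode_linear] Suc.prems(1)])
  have "of_homogeneous (Suc n) (to_homogeneous (Suc n) F) xs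
      = shear (\<lambda>x. x) (behind (\<lambda>G. of_homogeneous n (to_homogeneous n G)) (shear S F)) xs"
    by (simp add: behind_behind)
  also have "\<dots> = shear (\<lambda>x. x) (behind (\<lambda>G. G) (shear S F)) xs"
    by (intro operator_cong[OF operator_shear[OF linear_ident] _ Suc.prems(2)] behind_cong[OF _ S] Suc.IH)
  also have "\<dots> = shear (\<lambda>x. x) (shear S F) xs"
    by (intro operator_cong[OF operator_shear[OF linear_ident] _ Suc.prems(2)])
       (auto simp: length_Suc_conv)
  also have "\<dots> = F xs"
    by (rule shear_S_shear_id(2)[OF Suc.prems])
  finally show ?case .
qed simp

section \<open>Exchange of neighbouring coordinates\<close>

definition swap_at :: "nat \<Rightarrow> ('a list \<Rightarrow> 'v) \<Rightarrow> 'a list \<Rightarrow> 'v"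
  where "swap_at p F xs = F (xs[p := xs ! Suc p, Suc p := xs ! p])"

text \<open>
  The formula for \<open>-\<sigma>\<^sub>i\<close> with \<open>i = p + 1\<close>, on multilinear functions.  If \<open>a\<^sub>i\<close> is the last entry, then
  \<open>act_head\<close> contributes the factor \<open>\<epsilon> (a\<^sub>i\<^sup>3)\<close>, and the counit axiom turns the general formula into that
  for \<open>\<sigma>\<^sub>n\<close>.
\<close>

primrec hopf_swap :: "nat \<Rightarrow> ('a list \<Rightarrow> 'v) \<Rightarrow> 'a list \<Rightarrow> 'v" where
  "hopf_swap 0 = (\<lambda>F xs. sweedler (xs ! 1) (\<lambda>b1 b2. sweedler b1 (\<lambda>c1 c2.
     act_head b2 (\<lambda>zs. F (xs ! 0 * c1 # S c2 # zs)) (drop 2 xs))))"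
| "hopf_swap (Suc p) = behind (hopf_swap p)"

lemma hopf_swap_0_Cons [simp]:
  "hopf_swap 0 F (a # b # zs) = sweedler b (\<lambda>b1 b2. sweedler b1 (\<lambda>c1 c2. act_head b2 (\<lambda>zs. F (a * c1 # S c2 # zs)) zs))"
  by simp

declare hopf_swap.simps(1) [simp del]

lemma trilin_act_head:
  assumes "multilin (Suc (Suc (length xs))) F"
  shows "trilin (\<lambda>u v c. act_head c (\<lambda>zs. F (u # v # zs)) xs)"
  unfolding trilin_def
proof (intro conjI allI)
  show "bilin (\<lambda>v c. act_head c (\<lambda>zs. F (u # v # zs)) xs)" for u
    using assms by (intro bilin_act_head) (simp add: multilinear_Suc)
  show "lin (\<lambda>u. act_head c (\<lambda>zs. F (u # v # zs)) xs)" for v c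
    using assms by (cases xs) (auto simp: lin_iff multilinear_Suc V.scale_right_distrib mult.commute)
qed

lemma operator_hopf_swap_0: "operator (Suc (Suc n)) (Suc (Suc n)) (hopf_swap 0)"
  unfolding operator_def
proof (intro conjI allI impI)
  fix F G :: "'a list \<Rightarrow> 'v" and xs :: "'a list"
  assume xs: "length xs = Suc (Suc n)"
  show "hopf_swap 0 F xs = hopf_swap 0 G xs" if "\<forall>ys. length ys = Suc (Suc n) \<longrightarrow> F ys = G ys"
  proof -
    have "act_head c (\<lambda>zs. F (u # v # zs)) (drop 2 xs) = act_head c (\<lambda>zs. G (u # v # zs)) (drop 2 xs)" for u v c
      by (rule operator_cong[OF operator_act_head]) (use that xs in auto)
    then show ?thesis by (simp add: hopf_swap.simps(1))
  qed
  show "hopf_swap 0 (\<lambda>ys. F ys + G ys) xs = hopf_swap 0 F xs + hopf_swap 0 G xs"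
    by (simp add: hopf_swap.simps(1) act_head_add sweedler_add)
next
  fix c and F :: "'a list \<Rightarrow> 'v" and xs :: "'a list"
  show "hopf_swap 0 (\<lambda>ys. sc c (F ys)) xs = sc c (hopf_swap 0 F xs)"
    by (simp add: hopf_swap.simps(1) act_head_scale sweedler_scale)
next
  fix F :: "'a list \<Rightarrow> 'v"
  assume F: "multilin (Suc (Suc n)) F"
  have T: "trilin (\<lambda>u v c. act_head c (\<lambda>zs. F (u # v # zs)) zs)" if "length zs = n" for zs
    using F that by (intro trilin_act_head) simp
  show "multilin (Suc (Suc n)) (hopf_swap 0 F)"
    unfolding multilinear_Suc
  proof (intro conjI allI impI)
    fix ys :: "'a list" assume "length ys = Suc n"
    then obtain b zs where ys: "ys = b # zs" "length zs = n"
      by (auto simp: length_Suc_conv)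
    show "lin (\<lambda>a. hopf_swap 0 F (a # ys))"
      using T[OF ys(2)]
      by (simp add: ys(1) lin_iff trilin_def distrib_right sweedler_add sweedler_scale)
  next
    fix a and zs :: "'a list" assume "length zs = n"
    note T = T[OF this]
    have b1: "bilin (\<lambda>c1 c2. act_head b2 (\<lambda>zs. F (a * c1 # S c2 # zs)) zs)" for b2
      using T by (simp add: bilin_def lin_iff trilin_def distrib_left)
    have b2: "bilin (\<lambda>b1 b2. sweedler b1 (\<lambda>c1 c2. act_head b2 (\<lambda>zs. F (a * c1 # S c2 # zs)) zs))"
      unfolding bilin_def lin_iff sweedler_arg_add[OF b1] sweedler_arg_scl[OF b1]
      using T by (simp add: bilin_def lin_iff trilin_def sweedler_add sweedler_scale)
    show "lin (\<lambda>b. hopf_swap 0 F (a # b # zs))"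
      by (simp add: lin_iff sweedler_arg_add[OF b2] sweedler_arg_scl[OF b2])
  next
    fix a b
    have "multilin n (\<lambda>zs. F (u # v # zs))" for u v
      using F by (simp add: multilinear_Suc)
    then show "multilin n (\<lambda>zs. hopf_swap 0 F (a # b # zs))"
      by (simp add: multilin_sweedler multilin_act_head)
  qed
qed

lemma operator_hopf_swap: "Suc p < n \<Longrightarrow> operator n n (hopf_swap p)"
proof (induction p arbitrary: n)
  case 0
  then show ?case by (cases n rule: nat.exhaust; cases "n - 1") (auto intro: operator_hopf_swap_0)
next
  case (Suc p)
  then show ?case by (cases n) (auto intro: operator_behind)
qed

lemma length_ge_2_cases:
  assumes "Suc 0 < length xs"
  obtains a b cs where "xs = a # b # cs"
  using assms by (cases xs rule: list.exhaust; cases "tl xs") auto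

lemma multilin_append: "multilin (length us + n) F \<Longrightarrow> multilin n (\<lambda>zs. F (us @ zs))"
proof (induction us arbitrary: F)
  case (Cons u us)
  then show ?case
    using Cons.IH[of "\<lambda>zs. F (u # zs)"] by (simp add: multilinear_Suc)
qed simp

lemma hopf_swap_nth:
  "Suc p < length xs \<Longrightarrow> hopf_swap p F xs = sweedler (xs ! Suc p) (\<lambda>b1 b2. sweedler b1 (\<lambda>c1 c2.
     act_head b2 (\<lambda>zs. F (take p xs @ (xs ! p * c1) # S c2 # zs)) (drop (p + 2) xs)))"
proof (induction p arbitrary: F xs)
  case 0
  then show ?case by (auto elim: length_ge_2_cases)
next
  case (Suc p)
  then show ?case by (cases xs) auto
qed

text \<open>
  The formula multiplies the first entry at most from the right.
\<close>

lemma act_head_hopf_swap: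
  assumes "Suc p < length xs"
  shows "act_head b (hopf_swap p F) xs = hopf_swap p (act_head b F) xs"
proof (cases p)
  case 0
  then obtain x y zs where "xs = x # y # zs"
    using assms by (cases xs rule: list.exhaust; cases "tl xs") auto
  then show ?thesis
    by (simp add: 0 mult.assoc)
next
  case (Suc q)
  then show ?thesis
    using assms by (cases xs) auto
qed

lemma shear_behind_hopf_swap:
  assumes "Suc p < n" "length xs = Suc n"
  shows "shear g (behind (hopf_swap p) F) xs = behind (hopf_swap p) (shear g F) xs"
proof -
  obtain x zs where xs: "xs = x # zs" "length zs = n"
    using assms(2) by (auto simp: length_Suc_conv)
  then show ?thesis
    using assms(1) by (simp add: act_head_hopf_swap operator_sweedler[OF operator_hopf_swap[OF assms(1)] xs(2)])
qed

end

context cocommutative_hopf_coefficients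
begin

text \<open>
  At the head of the list two shears are involved on each side, the changes of coordinates of the
  remaining entries cancel, and the claim is \<open>sweedler_conjugated_swap\<close>.
\<close>

lemma hopf_swap_conjugate_swap_0:
  assumes "multilin n F" "n = Suc (Suc m)" "length xs = n"
  shows "of_homogeneous n (swap_at 0 (to_homogeneous n F)) xs = hopf_swap 0 F xs"
proof -
  obtain a b cs where xs: "xs = a # b # cs" "length cs = m"
    using assms(2,3) by (auto simp: length_Suc_conv)
  \<comment> \<open>The partial result of the two head shears, at an entry \<open>y\<close> followed by \<open>x\<close>.\<close>
  let ?J = "\<lambda>x y zs. sweedler x (\<lambda>x1 x2. sweedler y (\<lambda>u1 u2.
              act_head (S x2) (\<lambda>zs. F (u1 # S u2 * x1 # zs)) zs))"
  have J: "to_homogeneous n F (y # x # zs) = to_homogeneous m (?J x y) zs" for x y zs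
    by (simp add: assms(2) act_head_sweedler)
  have "multilin (Suc (Suc m)) (shear S F)"
    using operator_multilin[OF operator_shear[OF antipode_linear]] assms(1,2) by simp
  then have "multilin (Suc m) (shear S (\<lambda>zs. shear S F (y # zs)))" for y
    by (intro operator_multilin[OF operator_shear[OF antipode_linear]]) (simp add: multilinear_Suc)
  then have "multilin m (\<lambda>zs. shear S (\<lambda>zs. shear S F (y # zs)) (x # zs))" for x y
    by (simp only: multilinear_Suc)
  then have mJ: "multilin m (?J x y)" for x y
    by (simp add: act_head_sweedler)
  have inner: "act_head c (of_homogeneous m (to_homogeneous m (?J x y))) cs = act_head c (?J x y) cs" for c x y
    by (intro operator_cong[OF operator_act_head _ xs(2)] of_to_homogeneous mJ)
  have "of_homogeneous n (swap_at 0 (to_homogeneous n F)) xs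
      = sweedler a (\<lambda>a1 a2. sweedler (a2 * b) (\<lambda>y1 y2.
          act_head y2 (of_homogeneous m (to_homogeneous m (?J a1 y1))) cs))"
    by (simp add: xs(1) assms(2)) (simp add: swap_at_def J[unfolded assms(2)] act_head_sweedler del: to_homogeneous.simps)
  also have "\<dots> = sweedler a (\<lambda>a1 a2. sweedler (a2 * b) (\<lambda>y1 y2. sweedler a1 (\<lambda>x1 x2.
      sweedler y1 (\<lambda>u1 u2. act_head (S x2 * y2) (\<lambda>zs. F (u1 # S u2 * x1 # zs)) cs))))"
    by (simp add: inner act_head_sweedler)
  also have "\<dots> = hopf_swap 0 F xs"
    unfolding xs(1) hopf_swap_0_Cons
    using assms(1,2) xs(2) by (intro sweedler_conjugated_swap trilin_act_head) simp
  finally show ?thesis .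
qed

text \<open>
  The formula for \<open>-\<sigma>\<^sub>i\<close> is the exchange of two neighbouring homogeneous coordinates.  Away from the head
  of the list, the shear at the head commutes with the formula, and cancels against its inverse.
\<close>

theorem hopf_swap_conjugate_swap:
  "multilin n F \<Longrightarrow> length xs = n \<Longrightarrow> Suc p < n \<Longrightarrow>
    of_homogeneous n (swap_at p (to_homogeneous n F)) xs = hopf_swap p F xs"
proof (induction p arbitrary: n F xs)
  case 0
  then show ?case by (intro hopf_swap_conjugate_swap_0[of _ _ "n - 2"]) auto
next
  case (Suc p)
  then obtain m where n: "n = Suc m" "Suc p < m"
    by (cases n) auto
  note F = Suc.prems(1)[unfolded n(1)] and xs = Suc.prems(2)[unfolded n(1)]
  have S: "multilin (Suc m) (shear S F)"
    by (rule operator_multilin[OF operator_shear[OF antipode_linear] F])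
  \<comment> \<open>Behind the head, \<open>swap_at (Suc p)\<close> is \<open>swap_at p\<close>; this holds on nonempty lists only.\<close>
  have swap: "behind (of_homogeneous m) (swap_at (Suc p) G) ys = behind (of_homogeneous m) (behind (swap_at p) G) ys"
    if "length ys = Suc m" for G ys
    by (rule operator_cong[OF operator_behind[OF operator_of_homogeneous] _ that])
       (auto simp: swap_at_def length_Suc_conv)
  have "of_homogeneous n (swap_at (Suc p) (to_homogeneous n F)) xs
      = shear (\<lambda>x. x) (behind (of_homogeneous m) (behind (swap_at p) (behind (to_homogeneous m) (shear S F)))) xs"
    unfolding n(1) by (simp, intro operator_cong[OF operator_shear[OF linear_ident] _ xs] swap)
  also have "\<dots> = shear (\<lambda>x. x) (behind (hopf_swap p) (shear S F)) xs"
    unfolding behind_behind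
    by (intro operator_cong[OF operator_shear[OF linear_ident] _ xs] behind_cong[OF _ S] Suc.IH n(2))
  also have "\<dots> = behind (hopf_swap p) (shear (\<lambda>x. x) (shear S F)) xs"
    by (rule shear_behind_hopf_swap[OF n(2) xs])
  also have "\<dots> = hopf_swap (Suc p) F xs"
    unfolding hopf_swap.simps
    by (intro operator_cong[OF operator_behind[OF operator_hopf_swap[OF n(2)]] _ xs] shear_S_shear_id(2)[OF F])
  finally show ?case .
qed

end

section \<open>Permutation of coordinates\<close>

text \<open>
  The list \<open>h (\<pi> 1), \<dots>, h (\<pi> n)\<close>, where the entries of \<open>xs\<close> are \<open>h 1, \<dots>, h n\<close>; permutations act on
  \<open>{1..n}\<close>, positions of a list start at \<open>0\<close>.
\<close>

definition rearrange :: "(nat \<Rightarrow> nat) \<Rightarrow> 'b list \<Rightarrow> 'b list"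
  where "rearrange \<pi> xs = map (\<lambda>j. xs ! (\<pi> (Suc j) - 1)) [0..<length xs]"

lemma length_rearrange [simp]: "length (rearrange \<pi> xs) = length xs"
  by (simp add: rearrange_def)

lemma nth_rearrange: "j < length xs \<Longrightarrow> rearrange \<pi> xs ! j = xs ! (\<pi> (Suc j) - 1)"
  by (simp add: rearrange_def)

lemma rearrange_id: "rearrange id xs = xs"
  by (rule nth_equalityI) (simp_all add: nth_rearrange)

lemma permutes_index:
  assumes "\<pi> permutes {1..n}" "j < n"
  shows "\<pi> (Suc j) - 1 < n" "Suc (\<pi> (Suc j) - 1) = \<pi> (Suc j)"
proof -
  have "\<pi> (Suc j) \<in> {1..n}"
    using permutes_in_image[OF assms(1), of "Suc j"] assms(2) by simp
  then show "\<pi> (Suc j) - 1 < n" "Suc (\<pi> (Suc j) - 1) = \<pi> (Suc j)"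
    by auto
qed

text \<open>
  The order of the two permutations on the right is reversed; transposition to functions reverses it
  once more, so that \<open>signed_rearrange\<close> is a left action.
\<close>

lemma rearrange_comp:
  assumes "\<tau> permutes {1..length xs}"
  shows "rearrange (\<pi> \<circ> \<tau>) xs = rearrange \<tau> (rearrange \<pi> xs)"
  using permutes_index[OF assms] by (intro nth_equalityI) (simp_all add: nth_rearrange)

lemma rearrange_update:
  assumes "\<pi> permutes {1..length xs}" "j < length xs"
  shows "rearrange \<pi> (xs[\<pi> (Suc j) - 1 := x]) = (rearrange \<pi> xs)[j := x]"
proof (rule nth_equalityI)
  fix i assume "i < length (rearrange \<pi> (xs[\<pi> (Suc j) - 1 := x]))"
  then have i: "i < length xs" by simp
  have "\<pi> (Suc j) - 1 = \<pi> (Suc i) - 1 \<longleftrightarrow> j = i"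
    using permutes_index(2)[OF assms(1) i] permutes_index(2)[OF assms]
      permutes_inj[OF assms(1), THEN injD, of "Suc j" "Suc i"] by (metis nat.inject)
  then show "rearrange \<pi> (xs[\<pi> (Suc j) - 1 := x]) ! i = (rearrange \<pi> xs)[j := x] ! i"
    using i permutes_index(1)[OF assms] by (simp add: nth_rearrange nth_list_update)
qed simp

lemma rearrange_adjacent:
  assumes "Suc p < length xs"
  shows "rearrange (transpose (Suc p) (Suc (Suc p))) xs = xs[p := xs ! Suc p, Suc p := xs ! p]"
  using assms by (intro nth_equalityI) (auto simp: nth_rearrange nth_list_update transpose_def)

lemma multilinear_update:
  "multilinear scl sc n F \<longleftrightarrow>
    (\<forall>xs j. length xs = n \<longrightarrow> j < n \<longrightarrow> Vector_Spaces.linear scl sc (\<lambda>x. F (xs[j := x])))"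
proof safe
  fix xs :: "'b list" and j
  assume F: "multilinear scl sc (length xs) F" and j: "j < length xs"
  then show "Vector_Spaces.linear scl sc (\<lambda>x. F (xs[j := x]))"
    by (simp add: upd_conv_take_nth_drop multilinear_def)
next
  assume *: "\<forall>xs j. length xs = n \<longrightarrow> j < n \<longrightarrow> Vector_Spaces.linear scl sc (\<lambda>x. F (xs[j := x]))"
  show "multilinear scl sc n F"
    unfolding multilinear_def
  proof (intro allI impI)
    fix xs ys :: "'b list"
    assume "length xs + 1 + length ys = n"
    then show "Vector_Spaces.linear scl sc (\<lambda>x. F (xs @ x # ys))"
      using *[rule_format, of "xs @ undefined # ys" "length xs"] by simp
  qed
qed

lemma adjacent_permutes: "p < n \<Longrightarrow> transpose (Suc p) (Suc (Suc p)) permutes {1..n + 1}"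
  by (intro permutes_swap_id) auto

text \<open>
  The adjacent transpositions generate the symmetric group.  This gives the uniqueness of the action,
  reduces invariance to the \<open>\<sigma>\<^sub>i\<close>, and transfers \<open>A\<close>-linearity from the \<open>\<sigma>\<^sub>i\<close> to the whole group.
\<close>

lemma permutes_adjacent_induct [consumes 1, case_names id adjacent]:
  assumes "\<pi> permutes {1..n + 1}" "P id"
    and adj: "\<And>p \<pi>. p < n \<Longrightarrow> \<pi> permutes {1..n + 1} \<Longrightarrow> P \<pi> \<Longrightarrow>
      P (transpose (Suc p) (Suc (Suc p)) \<circ> \<pi>)"
  shows "P \<pi>"
proof -
  \<comment> \<open>For \<open>a < b\<close>, the word \<open>adj_transp_seq a b\<close> factors \<open>transpose a b\<close> into adjacent transpositions.\<close>
  have word: "apply_adj_transps ts \<circ> \<pi> permutes {1..n + 1} \<and> P (apply_adj_transps ts \<circ> \<pi>)"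
    if "set ts \<subseteq> {1..n}" "\<pi> permutes {1..n + 1}" "P \<pi>" for ts \<pi>
    using that(1)
  proof (induction ts)
    case Nil
    then show ?case using that by simp
  next
    case (Cons t ts)
    then obtain p where p: "t = Suc p" "p < n" by (cases t) auto
    note t = adjacent_permutes[OF p(2)]
    have IH: "apply_adj_transps ts \<circ> \<pi> permutes {1..n + 1}" "P (apply_adj_transps ts \<circ> \<pi>)"
      using Cons.IH Cons.prems by (meson set_subset_Cons subset_trans)+
    have "apply_adj_transps (t # ts) \<circ> \<pi> = transpose (Suc p) (Suc (Suc p)) \<circ> (apply_adj_transps ts \<circ> \<pi>)"
      by (simp add: p(1) fun_eq_iff)
    then show ?case
      using permutes_compose[OF IH(1) t] adj[OF p(2) IH] by metis
  qed
  have ordered: "P (transpose a b \<circ> \<pi>)"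
    if "a \<in> {1..n + 1}" "b \<in> {1..n + 1}" "a < b" "\<pi> permutes {1..n + 1}" "P \<pi>" for a b \<pi>
  proof -
    have "set (adj_transp_seq a b) \<subseteq> {1..n}"
      unfolding set_adj_transp_seq[OF that(3)] using that(1,2) by auto
    from word[OF this that(4,5)] show ?thesis
      by (simp add: adj_transp_seq_correct[OF that(3)])
  qed
  from assms(1) finite_atLeastAtMost show ?thesis
  proof (induction rule: permutes_induct)
    case (swap a b \<pi>)
    then consider "a < b" | "b < a" by linarith
    then show ?case
      using swap ordered[of a b \<pi>] ordered[of b a \<pi>]
      by cases (simp_all only: transpose_commute[of a b] simp_thms)
  qed (rule assms(2))
qed

context hopf_coefficients
begin

definition signed_rearrange :: "(nat \<Rightarrow> nat) \<Rightarrow> ('a list \<Rightarrow> 'v) \<Rightarrow> 'a list \<Rightarrow> 'v"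
  where "signed_rearrange \<pi> F xs = sc (of_int (sign \<pi>)) (F (rearrange \<pi> xs))"

lemma operator_signed_rearrange:
  assumes "\<pi> permutes {1..n}"
  shows "operator n n (signed_rearrange \<pi>)"
  unfolding operator_def
proof (intro conjI allI impI)
  fix F :: "'a list \<Rightarrow> 'v"
  assume F: "multilin n F"
  have "multilin n (\<lambda>xs. F (rearrange \<pi> xs))"
    unfolding multilinear_update
  proof (intro allI impI)
    fix xs :: "'a list" and j
    assume xs: "length xs = n" and "j < n"
    then have "inv' \<pi> (Suc j) \<in> {1..n}"
      using permutes_in_image[OF permutes_inv[OF assms], of "Suc j"] by simp
    then obtain i where i: "inv' \<pi> (Suc j) = Suc i" "i < n"
      by (cases "inv' \<pi> (Suc j)") auto
    then have "\<pi> (Suc i) = Suc j"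
      using permutes_inverses(1)[OF assms, of "Suc j"] by simp
    then show "lin (\<lambda>x. F (rearrange \<pi> (xs[j := x])))"
      using rearrange_update[of \<pi> xs i] assms xs i(2) F by (simp add: multilinear_update)
  qed
  then show "multilin n (signed_rearrange \<pi> F)"
    unfolding signed_rearrange_def by (rule multilin_scale)
qed (simp_all add: signed_rearrange_def V.scale_right_distrib mult.commute)

text \<open>
  Permutation of homogeneous coordinates, twisted by the sign.  Defining the action this way makes the
  relations of the symmetric group evident, so no presentation by the \<open>\<sigma>\<^sub>i\<close> is needed.
\<close>

definition perm_action :: "nat \<Rightarrow> (nat \<Rightarrow> nat) \<Rightarrow> ('a list \<Rightarrow> 'v) \<Rightarrow> 'a list \<Rightarrow> 'v"
  where "perm_action n \<pi> F = of_homogeneous n (signed_rearrange \<pi> (to_homogeneous n F))"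

lemma operator_perm_action: "\<pi> permutes {1..n} \<Longrightarrow> operator n n (perm_action n \<pi>)"
  unfolding perm_action_def
  by (rule operator_comp[OF operator_comp[OF operator_to_homogeneous operator_signed_rearrange]
        operator_of_homogeneous])

lemma perm_action_id:
  assumes "multilin n F" "length xs = n"
  shows "perm_action n id F xs = F xs"
proof -
  have "signed_rearrange id G = G" for G
    by (rule ext) (simp add: signed_rearrange_def rearrange_id)
  then show ?thesis
    by (simp add: perm_action_def of_to_homogeneous[OF assms])
qed

lemma perm_action_comp:
  assumes "multilin n F" "length xs = n" "\<pi> permutes {1..n}" "\<tau> permutes {1..n}"
  shows "perm_action n (\<pi> \<circ> \<tau>) F xs = perm_action n \<pi> (perm_action n \<tau> F) xs"
proof -
  let ?G = "to_homogeneous n F"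
  have G: "multilin n (signed_rearrange \<tau> ?G)"
    by (intro operator_multilin[OF operator_signed_rearrange] operator_multilin[OF operator_to_homogeneous] assms)
  have "permutation \<pi>" "permutation \<tau>"
    using assms(3,4) by (auto simp: permutation_permutes)
  then have comp: "signed_rearrange (\<pi> \<circ> \<tau>) ?G ys = signed_rearrange \<pi> (signed_rearrange \<tau> ?G) ys"
    if "length ys = n" for ys
    using that assms(4) by (simp add: signed_rearrange_def rearrange_comp sign_compose)
  also have "\<dots> ys = signed_rearrange \<pi> (to_homogeneous n (of_homogeneous n (signed_rearrange \<tau> ?G))) ys"
    if "length ys = n" for ys
    using that by (intro operator_cong[OF operator_signed_rearrange[OF assms(3)]] to_of_homogeneous[OF G, symmetric])
  finally show ?thesis
    unfolding perm_action_def
    by (intro operator_cong[OF operator_of_homogeneous] assms(2))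
qed

section \<open>Faces and the differential\<close>

text \<open>
  The transpose of \<open>a\<^sub>0 \<otimes> \<dots> \<otimes> a\<^sub>n \<mapsto> \<dots> \<otimes> a\<^sub>i a\<^sub>i\<^sub>+\<^sub>1 \<otimes> \<dots>\<close>, and for \<open>i = n\<close> of the map that applies the counit
  to \<open>a\<^sub>n\<close>.  The last case is covered by the convention for \<open>act_head\<close> on the empty list.
\<close>

primrec face :: "nat \<Rightarrow> ('a list \<Rightarrow> 'v) \<Rightarrow> 'a list \<Rightarrow> 'v" where
  "face 0 = (\<lambda>F xs. act_head (hd xs) F (tl xs))"
| "face (Suc i) = behind (face i)"

lemma operator_face_0: "operator n (Suc n) (face 0)"
  unfolding operator_def
proof (intro conjI allI impI)
  fix F G :: "'a list \<Rightarrow> 'v" and xs :: "'a list"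
  assume "length xs = Suc n"
  then show "face 0 F xs = face 0 G xs" if "\<forall>ys. length ys = n \<longrightarrow> F ys = G ys"
    unfolding face.simps by (intro operator_cong[OF operator_act_head]) (use that in auto)
qed (simp_all add: act_head_add act_head_scale multilinear_Suc lin_act_head multilin_act_head)

lemma operator_face: "i \<le> n \<Longrightarrow> operator n (Suc n) (face i)"
proof (induction i arbitrary: n)
  case 0 show ?case by (rule operator_face_0)
next
  case (Suc i) then show ?case by (cases n) (auto intro: operator_behind)
qed

lemma act_head_face: "i < length xs \<Longrightarrow> act_head b (face i F) xs = face i (act_head b F) xs"
  by (cases xs; cases i) auto

lemma face_eq_merge: "Suc i < length xs \<Longrightarrow> face i F xs = F (merge_at i xs)"
proof (induction i arbitrary: xs F)
  case 0
  then show ?case by (cases xs rule: list.exhaust; cases "tl xs") (auto simp: merge_at_def)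
next
  case (Suc i)
  then show ?case by (cases xs) (auto simp: merge_at_def)
qed

lemma face_last: "length xs = Suc n \<Longrightarrow> face n F xs = sc (\<epsilon> (xs ! n)) (F (take n xs))"
proof (induction n arbitrary: xs F)
  case 0
  then show ?case by (auto simp: length_Suc_conv)
next
  case (Suc i)
  then show ?case by (cases xs) auto
qed

text \<open>
  The next four lemmas say that faces and \<open>\<sigma>\<^sub>i\<close> interact like the deletion of a coordinate and the
  exchange of neighbouring coordinates.  If the merged entries lie in front of the exchanged
  coordinates, the claim is that \<open>act_head\<close> commutes with the formula; if they lie behind, that
  \<open>act_head\<close> commutes with faces.
\<close>

lemma hopf_swap_face_less:
  "i < p \<Longrightarrow> Suc p < length xs \<Longrightarrow> hopf_swap p (face i F) xs = face i (hopf_swap (p - 1) F) xs"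
proof (induction p arbitrary: i xs F)
  case (Suc p)
  then obtain x ys where xs: "xs = x # ys" "Suc p < length ys"
    by (cases xs) auto
  show ?case
  proof (cases i)
    case 0
    then show ?thesis using xs act_head_hopf_swap[of p ys x F] by simp
  next
    case i: (Suc j)
    then obtain q where "p = Suc q"
      using Suc.prems(1) by (cases p) auto
    then show ?thesis using xs i Suc.IH[of j ys] Suc.prems(1) by simp
  qed
qed simp

lemma hopf_swap_face_greater:
  "Suc p < i \<Longrightarrow> i < length xs \<Longrightarrow> hopf_swap p (face i F) xs = face i (hopf_swap p F) xs"
proof (induction p arbitrary: i xs F)
  case 0
  then obtain a b cs where xs: "xs = a # b # cs"
    using length_ge_2_cases[of xs] by auto
  obtain k where i: "i = Suc (Suc k)" "k < length cs"
    using 0 xs by (cases i rule: nat.exhaust; cases "i - 1") auto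
  obtain n where n: "length cs = Suc n" "k \<le> n"
    using i(2) by (cases "length cs") auto
  show ?case
    by (simp add: xs i(1) act_head_face[OF i(2)] operator_sweedler[OF operator_face[OF n(2)] n(1)])
next
  case (Suc p)
  then show ?case by (cases xs; cases i) auto
qed

text \<open>
  Here \<open>(a b\<^sup>1) S b\<^sup>2\<close> is contracted by the antipode axiom, which leaves \<open>b\<close> to multiply the next entry.
\<close>

lemma hopf_swap_face_same:
  "Suc p < length xs \<Longrightarrow> multilin (length xs - 1) F \<Longrightarrow> hopf_swap p (face p F) xs = face (Suc p) F xs"
proof (induction p arbitrary: xs F)
  case 0
  then obtain a b cs where xs: "xs = a # b # cs"
    using length_ge_2_cases[of xs] by auto
  have "bilin (\<lambda>u v. act_head v (\<lambda>ys. F (u # ys)) cs)"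
    using 0 xs by (intro bilin_act_head) simp
  then have "bilin (\<lambda>u v. act_head v (\<lambda>ys. F (a * u # ys)) cs)"
    by (simp add: bilin_def lin_iff distrib_left)
  from sweedler_merge_left[OF this, of b] show ?case
    by (simp add: xs mult.assoc)
next
  case (Suc p)
  obtain x y ys where xs: "xs = x # y # ys"
    using Suc.prems(1) by (auto intro: length_ge_2_cases[of xs])
  with Suc.prems show ?case
    using Suc.IH[of "y # ys" "\<lambda>ys. F (x # ys)"] by (simp add: multilinear_Suc)
qed

text \<open>
  Here \<open>S b\<^sup>2 b\<^sup>3\<close> is contracted, which leaves the product \<open>a b\<close>.
\<close>

lemma hopf_swap_face_Suc:
  "Suc p < length xs \<Longrightarrow> multilin (length xs - 1) F \<Longrightarrow> hopf_swap p (face (Suc p) F) xs = face p F xs"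
proof (induction p arbitrary: xs F)
  case 0
  then obtain a b cs where xs: "xs = a # b # cs"
    using length_ge_2_cases[of xs] by auto
  have "bilin (\<lambda>u v. act_head v (\<lambda>ys. F (u # ys)) cs)"
    using 0 xs by (intro bilin_act_head) simp
  then have "bilin (\<lambda>u v. act_head v (\<lambda>ys. F (a * u # ys)) cs)"
    by (simp add: bilin_def lin_iff distrib_left)
  from sweedler_antipode_left_counit[OF this, of b] show ?case
    by (simp add: xs)
next
  case (Suc p)
  obtain x y ys where xs: "xs = x # y # ys"
    using Suc.prems(1) by (auto intro: length_ge_2_cases[of xs])
  with Suc.prems show ?case
    using Suc.IH[of "y # ys" "\<lambda>ys. F (x # ys)"] by (simp add: multilinear_Suc)
qed

definition differential :: "nat \<Rightarrow> ('a list \<Rightarrow> 'v) \<Rightarrow> 'a list \<Rightarrow> 'v"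
  where "differential n F xs = (\<Sum>i\<le>n. sc ((- 1) ^ i) (face i F xs))"

lemma multilin_differential: "multilin n F \<Longrightarrow> multilin (Suc n) (differential n F)"
  unfolding differential_def
  by (intro multilin_sum multilin_scale operator_multilin[OF operator_face]) auto

text \<open>
  The alternating sum of the faces of an alternating function is alternating: \<open>\<sigma>\<^sub>p\<^sub>+\<^sub>1\<close> permutes the
  terms of the sum, exchanging the faces \<open>p\<close> and \<open>p + 1\<close>, whose signs are opposite, and acts on every
  other face as one of the \<open>\<sigma>\<^sub>i\<close> on \<open>F\<close>.
\<close>

theorem hopf_swap_differential:
  assumes F: "multilin n F" and xs: "length xs = Suc n" and p: "p < n"
    and inv: "\<And>q ys. Suc q < n \<Longrightarrow> length ys = n \<Longrightarrow> hopf_swap q F ys = - F ys"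
  shows "hopf_swap p (differential n F) xs = - differential n F xs"
proof -
  let ?t = "transpose p (Suc p)"
  let ?h = "\<lambda>i. sc ((- 1) ^ i) (face i F xs)"
  have op: "operator (Suc n) (Suc n) (hopf_swap p)"
    using p by (intro operator_hopf_swap) simp
  have face_neg: "face i (hopf_swap q F) xs = - face i F xs" if "i \<le> n" "Suc q < n" for i q
  proof -
    have "face i (hopf_swap q F) xs = face i (\<lambda>ys. sc (- 1) (F ys)) xs"
      using that by (intro operator_cong[OF operator_face _ xs]) (simp_all add: inv)
    also have "\<dots> = sc (- 1) (face i F xs)"
      by (rule operator_scale[OF operator_face[OF that(1)] xs])
    finally show ?thesis by simp
  qed
  \<comment> \<open>For \<open>i = p, p + 1\<close> the minus sign is the change of \<open>(- 1) ^ i\<close>, for the other \<open>i\<close> it comes from \<open>inv\<close>.\<close>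
  have faces: "sc ((- 1) ^ i) (hopf_swap p (face i F) xs) = - ?h (?t i)" if i: "i \<le> n" for i
  proof -
    consider "i < p" | "i = p" | "i = Suc p" | "Suc p < i" by linarith
    then show ?thesis
    proof cases
      case 1
      then have "hopf_swap p (face i F) xs = - face i F xs"
        using hopf_swap_face_less[of i p xs F] face_neg[of i "p - 1"] xs p i by simp
      then show ?thesis using 1 by (simp add: transpose_def)
    next
      case 2
      then show ?thesis using hopf_swap_face_same[of p xs F] xs p F by simp
    next
      case 3
      then show ?thesis using hopf_swap_face_Suc[of p xs F] xs p F by simp
    next
      case 4
      then have "hopf_swap p (face i F) xs = - face i F xs"
        using hopf_swap_face_greater[of p i xs F] face_neg[of i p] xs p i by simp
      then show ?thesis using 4 by (simp add: transpose_def)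
    qed
  qed
  have "hopf_swap p (differential n F) xs = (\<Sum>i\<le>n. sc ((- 1) ^ i) (hopf_swap p (face i F) xs))"
    unfolding differential_def by (simp add: operator_sum[OF op xs] operator_scale[OF op xs])
  also have "\<dots> = - (\<Sum>i\<le>n. ?h (?t i))"
    by (simp add: faces sum_negf)
  also have "(\<Sum>i\<le>n. ?h (?t i)) = (\<Sum>i\<le>n. ?h i)"
    using sum.permute[OF permutes_swap_id[of p "{..n}" "Suc p"], of ?h] p by simp
  finally show ?thesis by (simp add: differential_def[abs_def])
qed

end

context cocommutative_hopf_coefficients
begin

text \<open>
  The sign of an adjacent transposition accounts for the sign in the formulas for \<open>\<sigma>\<^sub>i\<close>.
\<close>

lemma perm_action_adjacent:
  assumes "multilin n F" "length xs = n" "Suc p < n"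
  shows "perm_action n (transpose (Suc p) (Suc (Suc p))) F xs = - hopf_swap p F xs"
proof -
  have "signed_rearrange (transpose (Suc p) (Suc (Suc p))) G ys = sc (- 1) (swap_at p G ys)"
    if "length ys = n" for G ys
    using that assms(3) by (simp add: signed_rearrange_def swap_at_def rearrange_adjacent sign_swap_id)
  then have "perm_action n (transpose (Suc p) (Suc (Suc p))) F xs
      = of_homogeneous n (\<lambda>ys. sc (- 1) (swap_at p (to_homogeneous n F) ys)) xs"
    unfolding perm_action_def by (intro operator_cong[OF operator_of_homogeneous _ assms(2)])
  also have "\<dots> = sc (- 1) (hopf_swap p F xs)"
    by (simp only: operator_scale[OF operator_of_homogeneous assms(2)] hopf_swap_conjugate_swap[OF assms])
  finally show ?thesis by simp
qed

end

section \<open>Cochains as equivariant multilinear functions\<close>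

locale hopf_cochains = cocommutative_hopf_algebra scl \<Delta> \<epsilon> S + left_module act
  for scl :: "'k::field \<Rightarrow> 'a::ring_1 \<Rightarrow> 'a" and \<Delta> :: "'a \<Rightarrow> ('a, 'k) tensor"
    and \<epsilon> :: "'a \<Rightarrow> 'k" and S :: "'a \<Rightarrow> 'a"
    and act :: "'a \<Rightarrow> 'm::ab_group_add \<Rightarrow> 'm"
begin

lemma vector_space_module_scale: "vector_space (module_scale scl act)"
  by unfold_locales
     (simp_all add: module_scale_def act_add_right scale_left_distrib act_add_left act_act act_one
       scl_mult_left)

end

sublocale hopf_cochains \<subseteq> cocommutative_hopf_coefficients scl \<Delta> \<epsilon> S "module_scale scl act"
  by (intro cocommutative_hopf_coefficients.intro hopf_coefficients.intro
      vector_space_module_scale cocommutative_hopf_algebra_axioms hopf_algebra_axioms)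

context hopf_cochains
begin

abbreviation "sc \<equiv> module_scale scl act"

lemma act_zero: "act b 0 = 0"
  using act_add_right[of b 0 0] by simp

lemma act_scale: "act b (sc c m) = sc c (act b m)"
  by (simp add: module_scale_def act_act)

lemma act_sum: "act b (\<Sum>i\<in>I. f i) = (\<Sum>i\<in>I. act b (f i))"
  by (induction I rule: infinite_finite_induct) (simp_all add: act_zero act_add_right)

lemma act_lin_ext: "act b (lin_ext sc F u) = lin_ext sc (\<lambda>x. act b (F x)) u"
  by (simp add: lin_ext_def act_sum act_scale)

lemma act_sweedler: "act b (sweedler a B) = sweedler a (\<lambda>x y. act b (B x y))"
  by (simp add: sweedler_eq_sum act_sum act_scale)

lemma act_head_act: "act_head c (\<lambda>ys. act b (F ys)) xs = act b (act_head c F xs)"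
  by (cases xs) (simp_all add: act_scale)

lemma hopf_swap_act: "hopf_swap p (\<lambda>ys. act b (F ys)) xs = act b (hopf_swap p F xs)"
  by (induction p arbitrary: F xs) (simp_all add: hopf_swap.simps(1) behind_def act_head_act act_sweedler)

lemma face_act: "face i (\<lambda>ys. act b (F ys)) xs = act b (face i F xs)"
  by (induction i arbitrary: F xs) (simp_all add: behind_def act_head_act)

text \<open>
  The \<open>A\<close>-linearity of a cochain, as a property of its multilinear function on lists of length \<open>n + 1\<close>.
\<close>

definition equivariant :: "nat \<Rightarrow> ('a list \<Rightarrow> 'm) \<Rightarrow> bool"
  where "equivariant n F \<longleftrightarrow> (\<forall>b x xs. length xs = n \<longrightarrow> F (b * x # xs) = act b (F (x # xs)))"

lemma equivariant_cong:
  assumes "equivariant n F" "\<And>xs. length xs = Suc n \<Longrightarrow> F xs = G xs"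
  shows "equivariant n G"
  using assms by (simp add: equivariant_def)

lemma equivariant_hopf_swap:
  assumes "p < n" "equivariant n F"
  shows "equivariant n (hopf_swap p F)"
  unfolding equivariant_def
proof (intro allI impI)
  fix b x and xs :: "'a list"
  assume xs: "length xs = n"
  show "hopf_swap p F (b * x # xs) = act b (hopf_swap p F (x # xs))"
  proof (cases p)
    case 0
    then obtain y cs where cs: "xs = y # cs" "n = Suc (length cs)"
      using xs assms(1) by (cases xs) auto
    have "act_head c (\<lambda>zs. F (b * x * u # v # zs)) cs = act_head c (\<lambda>zs. act b (F (x * u # v # zs))) cs" for c u v
      using assms(2) cs by (intro operator_cong[OF operator_act_head]) (auto simp: equivariant_def mult.assoc)
    then show ?thesis
      by (simp add: 0 cs(1) act_head_act act_sweedler)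
  next
    case (Suc q)
    have "hopf_swap q (\<lambda>ys. F (b * x # ys)) xs = hopf_swap q (\<lambda>ys. act b (F (x # ys))) xs"
      using assms Suc by (intro operator_cong[OF operator_hopf_swap _ xs]) (auto simp: equivariant_def)
    then show ?thesis
      by (simp add: Suc hopf_swap_act)
  qed
qed

lemma equivariant_face:
  assumes "0 < n" "i \<le> n" "equivariant (n - 1) F"
  shows "equivariant n (face i F)"
  unfolding equivariant_def
proof (intro allI impI)
  fix b x and xs :: "'a list"
  assume xs: "length xs = n"
  show "face i F (b * x # xs) = act b (face i F (x # xs))"
  proof (cases i)
    case 0
    then show ?thesis
      using assms xs by (cases xs) (auto simp: equivariant_def mult.assoc)
  next
    case (Suc j)
    obtain m where m: "n = Suc m"
      using assms(1) by (cases n) auto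
    have "face j (\<lambda>ys. F (b * x # ys)) xs = face j (\<lambda>ys. act b (F (x # ys))) xs"
      using assms Suc xs
      by (intro operator_cong[OF operator_face[of j m]]) (auto simp: equivariant_def m)
    then show ?thesis
      by (simp add: Suc face_act)
  qed
qed

lemma equivariant_differential:
  assumes "0 < n" "equivariant (n - 1) F"
  shows "equivariant n (differential n F)"
  using equivariant_face[OF assms(1) _ assms(2)]
  by (simp add: equivariant_def differential_def act_sum act_scale)

text \<open>
  In homogeneous coordinates \<open>A\<close> acts diagonally, through iterated coproducts.  It is simpler to use
  that the group is generated by the \<open>\<sigma>\<^sub>i\<close>, for which \<open>A\<close>-linearity is visible in the formula.
\<close>

lemma equivariant_perm_action:
  assumes "\<pi> permutes {1..n + 1}" "multilin (n + 1) F" "equivariant n F"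
  shows "equivariant n (perm_action (n + 1) \<pi> F)"
  using assms(1)
proof (induction rule: permutes_adjacent_induct)
  case id
  show ?case
    by (rule equivariant_cong[OF assms(3)], rule perm_action_id[OF assms(2), symmetric]) simp
next
  case (adjacent p \<pi>)
  let ?t = "transpose (Suc p) (Suc (Suc p))"
  note t = adjacent_permutes[OF adjacent.hyps(1)]
  let ?G = "perm_action (n + 1) \<pi> F"
  have G: "multilin (n + 1) ?G"
    by (rule operator_multilin[OF operator_perm_action[OF adjacent.hyps(2)] assms(2)])
  have "perm_action (n + 1) (?t \<circ> \<pi>) F xs = act (- 1) (hopf_swap p ?G xs)" if "length xs = n + 1" for xs
    using perm_action_comp[OF assms(2) that t adjacent.hyps(2)]
      perm_action_adjacent[OF G that, of p] adjacent.hyps(1) V.scale_minus_left[of 1 "hopf_swap p ?G xs"]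
    by (simp add: module_scale_def act_one)
  note eq = this
  have "equivariant n (\<lambda>xs. act (- 1) (hopf_swap p ?G xs))"
    using equivariant_hopf_swap[OF adjacent.hyps(1) adjacent.IH] by (simp add: equivariant_def act_act)
  then show ?case
    by (rule equivariant_cong, intro eq[symmetric]) simp
qed

lemma T_act_in: "X \<in> tensor_power scl (n + 1) \<Longrightarrow> T_act scl n b X \<in> tensor_power scl (n + 1)"
  unfolding T_act_def tensor_map_def
  by (intro tensor_class_in free_space_lin_ext free_space_single)
     (auto dest!: length_free_space[OF tensor_power_rep(1)])

text \<open>
  Multiplication of the first entry by \<open>b\<close> turns relations into relations, so the module structure
  can be computed on pure tensors.
\<close>

lemma T_act_pure:
  assumes "length xs = n"
  shows "T_act scl n b (pure_tensor scl (x # xs)) = pure_tensor scl (b * x # xs)"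
proof -
  interpret U: vector_space "free_scale :: 'k \<Rightarrow> ('a list \<Rightarrow>\<^sub>0 'k) \<Rightarrow> _"
    by (rule vector_space_free_scale)
  let ?g = "\<lambda>as. Poly_Mapping.single (b * hd as # tl as) (1::'k)"
  have "lin_ext free_scale ?g r \<in> multilinear_relations scl (n + 1)"
    if "r \<in> multilinear_relations scl (n + 1)" for r
  proof -
    from that consider us y z vs where "length us + 1 + length vs = n + 1"
        "r = Poly_Mapping.single (us @ (y + z) # vs) 1
          - Poly_Mapping.single (us @ y # vs) 1 - Poly_Mapping.single (us @ z # vs) 1"
      | us c y vs where "length us + 1 + length vs = n + 1"
        "r = Poly_Mapping.single (us @ scl c y # vs) 1
          - free_scale c (Poly_Mapping.single (us @ y # vs) 1)"
      unfolding multilinear_relations_def by blast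
    then show ?thesis
    proof cases
      case 1
      then show ?thesis
        using multilinear_relation_add[of "[]" vs "n + 1" "b * y" "b * z" scl]
          multilinear_relation_add[of "b * hd us # tl us" vs "n + 1" y z scl]
        by (cases us) (simp_all add: U.lin_ext_diff distrib_left)
    next
      case 2
      then show ?thesis
        using multilinear_relation_scale[of "[]" vs "n + 1" scl c "b * y"]
          multilinear_relation_scale[of "b * hd us # tl us" vs "n + 1" scl c y]
        by (cases us) (simp_all add: U.lin_ext_diff U.lin_ext_free_scale)
    qed
  qed
  then show ?thesis
    unfolding T_act_def pure_tensor_def using assms
    by (subst tensor_map_class[of _ "length (x # xs)"])
       (auto simp: free_space_single intro: U.span_base)
qed

text \<open>
  Cochains of degree \<open>n\<close> correspond to equivariant multilinear functions on lists of length \<open>n + 1\<close>; \<open>on_pure\<close>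
  and \<open>to_cochain\<close> are the two directions.  On lists of other lengths \<open>on_pure f\<close> has no significance.
\<close>

definition on_pure :: "(('a, 'k) tensor \<Rightarrow> 'm) \<Rightarrow> 'a list \<Rightarrow> 'm"
  where "on_pure f xs = f (pure_tensor scl xs)"

definition to_cochain :: "nat \<Rightarrow> ('a list \<Rightarrow> 'm) \<Rightarrow> ('a, 'k) tensor \<Rightarrow> 'm"
  where "to_cochain n F X = (if X \<in> tensor_power scl (n + 1) then tensor_lift sc F X else 0)"

lemma pure_tensor_in: "length xs = n \<Longrightarrow> pure_tensor scl xs \<in> tensor_power scl n"
  unfolding pure_tensor_def by (auto intro: tensor_class_in free_space_single)

lemma on_pure_to_cochain:
  "multilin (n + 1) F \<Longrightarrow> length xs = n + 1 \<Longrightarrow> on_pure (to_cochain n F) xs = F xs"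
  unfolding on_pure_def to_cochain_def
  by (simp add: pure_tensor_in tensor_lift_pure[OF vector_space_module_scale])

lemma to_cochain_in:
  assumes F: "multilin (n + 1) F" "equivariant n F"
  shows "to_cochain n F \<in> cochains scl act n"
  unfolding cochains_def
proof (intro CollectI conjI allI ballI impI)
  fix X Y
  assume XY: "X \<in> tensor_power scl (n + 1)" "Y \<in> tensor_power scl (n + 1)"
  then have "tensor_add scl (n + 1) X Y \<in> tensor_power scl (n + 1)"
    unfolding tensor_add_def by (intro tensor_class_in free_space_add tensor_power_rep)
  then show "to_cochain n F (tensor_add scl (n + 1) X Y) = to_cochain n F X + to_cochain n F Y"
    using XY tensor_lift_add_tensor[OF vector_space_module_scale F(1) XY] by (simp add: to_cochain_def)
next
  fix b X
  assume X: "X \<in> tensor_power scl (n + 1)"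
  have "tensor_lift sc F (T_act scl n b X) = tensor_lift sc (\<lambda>as. lin_ext sc F (Poly_Mapping.single (b * hd as # tl as) 1)) X"
    unfolding T_act_def
    by (rule tensor_lift_map[OF vector_space_module_scale F(1) X]) (simp add: free_space_single)
  also have "\<dots> = tensor_lift sc (\<lambda>as. act b (F as)) X"
    using F(2) by (intro tensor_lift_cong[OF X]) (auto simp: equivariant_def length_Suc_conv)
  also have "\<dots> = act b (tensor_lift sc F X)"
    by (simp add: tensor_lift_def act_lin_ext)
  finally show "to_cochain n F (T_act scl n b X) = act b (to_cochain n F X)"
    using X T_act_in[OF X] by (simp add: to_cochain_def)
qed (simp add: to_cochain_def)

context
  fixes n f
  assumes f: "f \<in> cochains scl act n"
begin

lemma cochain_class_add:
  "u \<in> free_space (n + 1) \<Longrightarrow> v \<in> free_space (n + 1) \<Longrightarrow>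
    f (tensor_class scl (n + 1) (u + v)) = f (tensor_class scl (n + 1) u) + f (tensor_class scl (n + 1) v)"
proof -
  assume uv: "u \<in> free_space (n + 1)" "v \<in> free_space (n + 1)"
  have "f (tensor_add scl (n + 1) X Y) = f X + f Y"
    if "X \<in> tensor_power scl (n + 1)" "Y \<in> tensor_power scl (n + 1)" for X Y
    using f that by (simp add: cochains_def)
  from this[OF tensor_class_in[OF uv(1)] tensor_class_in[OF uv(2)]] show ?thesis
    by (simp only: tensor_add_class[OF uv])
qed

lemma equivariant_on_pure: "equivariant n (on_pure f)"
  unfolding equivariant_def on_pure_def
proof (intro allI impI)
  fix b x and xs :: "'a list"
  assume xs: "length xs = n"
  then have "pure_tensor scl (x # xs) \<in> tensor_power scl (n + 1)"
    by (intro pure_tensor_in) simp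
  then have "f (T_act scl n b (pure_tensor scl (x # xs))) = act b (f (pure_tensor scl (x # xs)))"
    using f by (simp add: cochains_def)
  then show "f (pure_tensor scl (b * x # xs)) = act b (f (pure_tensor scl (x # xs)))"
    by (simp add: T_act_pure[OF xs])
qed

text \<open>
  Cochains are only required to be additive and \<open>A\<close>-linear; their homogeneity over \<open>k\<close> comes from
  moving the scalar to the first entry, where it acts as an element of \<open>A\<close>.
\<close>

lemma cochain_class_scale_pure:
  assumes "length xs = n + 1"
  shows "f (tensor_class scl (n + 1) (free_scale c (Poly_Mapping.single xs 1))) = sc c (on_pure f xs)"
proof -
  interpret U: vector_space "free_scale :: 'k \<Rightarrow> ('a list \<Rightarrow>\<^sub>0 'k) \<Rightarrow> _"
    by (rule vector_space_free_scale)
  obtain x ys where xs: "xs = x # ys" "length ys = n"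
    using assms by (auto simp: length_Suc_conv)
  have "Poly_Mapping.single (scl c x # ys) 1 - free_scale c (Poly_Mapping.single (x # ys) 1)
      \<in> multilinear_relations scl (n + 1)"
    using multilinear_relation_scale[of "[]" ys "n + 1" scl c x] xs(2) by simp
  then have "tensor_class scl (n + 1) (free_scale c (Poly_Mapping.single xs 1)) = pure_tensor scl (scl c x # ys)"
    unfolding pure_tensor_def using xs
    by (simp, intro tensor_class_eqI[symmetric] free_space_single free_space_scale U.span_base) auto
  also have "f \<dots> = sc c (on_pure f xs)"
    using equivariant_on_pure[unfolded equivariant_def, rule_format, OF xs(2), of "scl c 1" x]
    by (simp add: on_pure_def module_scale_def xs(1))
  finally show ?thesis .
qed

lemma multilin_on_pure: "multilin (n + 1) (on_pure f)"
  unfolding multilinear_def lin_iff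
proof (intro allI impI conjI)
  interpret U: vector_space "free_scale :: 'k \<Rightarrow> ('a list \<Rightarrow>\<^sub>0 'k) \<Rightarrow> _"
    by (rule vector_space_free_scale)
  fix us vs :: "'a list" and x
  assume len: "length us + 1 + length vs = n + 1"
  let ?s = "\<lambda>x. Poly_Mapping.single (us @ x # vs) (1::'k)"
  have pure: "on_pure f (us @ x # vs) = f (tensor_class scl (n + 1) (?s x))" for x
    using len by (simp add: on_pure_def pure_tensor_def)
  have free: "?s x \<in> free_space (n + 1)" for x
    using len by (intro free_space_single) simp
  {
    fix y
    have "?s (x + y) - ?s x - ?s y \<in> multilinear_relations scl (n + 1)"
      by (rule multilinear_relation_add[OF len])
    then have "?s (x + y) - (?s x + ?s y) \<in> U.span (multilinear_relations scl (n + 1))"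
      by (metis U.span_base diff_diff_eq)
    then have "tensor_class scl (n + 1) (?s (x + y)) = tensor_class scl (n + 1) (?s x + ?s y)"
      by (intro tensor_class_eqI free free_space_add)
    then show "on_pure f (us @ (x + y) # vs) = on_pure f (us @ x # vs) + on_pure f (us @ y # vs)"
      by (simp add: pure cochain_class_add free del: One_nat_def)
  next
    fix c
    have "?s (scl c x) - free_scale c (?s x) \<in> multilinear_relations scl (n + 1)"
      by (rule multilinear_relation_scale[OF len])
    then have "tensor_class scl (n + 1) (?s (scl c x)) = tensor_class scl (n + 1) (free_scale c (?s x))"
      by (intro tensor_class_eqI free free_space_scale U.span_base)
    then show "on_pure f (us @ scl c x # vs) = sc c (on_pure f (us @ x # vs))"
      using len cochain_class_scale_pure[of "us @ x # vs" c] by (simp add: pure)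
  }
qed

lemma cochain_class:
  assumes "u \<in> free_space (n + 1)"
  shows "f (tensor_class scl (n + 1) u) = lin_ext sc (on_pure f) u"
proof -
  let ?e = "\<lambda>x. free_scale (Poly_Mapping.lookup u x) (Poly_Mapping.single x (1::'k))"
  have free: "?e x \<in> free_space (n + 1)" if "x \<in> Poly_Mapping.keys u" for x
    using that assms by (intro free_space_scale free_space_single) (auto dest: length_free_space)
  have sums: "f (tensor_class scl (n + 1) (\<Sum>x\<in>A. ?e x)) = (\<Sum>x\<in>A. sc (Poly_Mapping.lookup u x) (on_pure f x))"
    if "finite A" "A \<subseteq> Poly_Mapping.keys u" for A
    using that
  proof (induction A rule: finite_induct)
    case empty
    show ?case using cochain_class_add[of 0 0] by (simp add: zero_in_free_space)
  next
    case (insert x A)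
    have "(\<Sum>x\<in>A. ?e x) \<in> free_space (n + 1)"
      using insert.prems by (intro free_space_sum free) auto
    then show ?case
      using insert free[of x] length_free_space[OF assms, of x]
      by (simp add: cochain_class_add cochain_class_scale_pure del: One_nat_def)
  qed
  have "(\<Sum>x\<in>Poly_Mapping.keys u. ?e x) = u"
    by (rule poly_mapping_eqI)
       (simp add: lookup_sum lookup_single when_def in_keys_iff if_distrib sum.delta cong: if_cong)
  with sums[of "Poly_Mapping.keys u"] show ?thesis by (simp add: lin_ext_def)
qed

lemma to_cochain_on_pure: "to_cochain n (on_pure f) = f"
proof
  fix X
  show "to_cochain n (on_pure f) X = f X"
  proof (cases "X \<in> tensor_power scl (n + 1)")
    case True
    then show ?thesis
      using cochain_class[OF tensor_power_rep(1)[OF True]] tensor_power_rep(2)[OF True]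
      by (simp add: to_cochain_def tensor_lift_def)
  next
    case False
    then show ?thesis
      using f by (simp add: to_cochain_def cochains_def)
  qed
qed

end

lemma to_cochain_cong:
  assumes "\<And>xs. length xs = n + 1 \<Longrightarrow> F xs = G xs"
  shows "to_cochain n F = to_cochain n G"
  using tensor_lift_cong[OF _ assms] by (auto simp: to_cochain_def fun_eq_iff)

lemma cochain_eqI:
  assumes "f \<in> cochains scl act n" "g \<in> cochains scl act n"
    and "\<And>xs. length xs = n + 1 \<Longrightarrow> on_pure f xs = on_pure g xs"
  shows "f = g"
  using to_cochain_cong[of n "on_pure f" "on_pure g", OF assms(3)]
  by (simp only: to_cochain_on_pure[OF assms(1)] to_cochain_on_pure[OF assms(2)])

section \<open>The action on cochains\<close>

text \<open>
  The threefold coproduct is an iterated Sweedler sum by its definition.  For the last index the general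
  formula has a third factor of the coproduct as well, which the counit removes.
\<close>

lemma sigma_formula_eq_hopf_swap:
  assumes f: "f \<in> cochains scl act n" and p: "p < n" and xs: "length xs = n + 1"
  shows "sigma_formula scl \<Delta> S act n (Suc p) f xs = - hopf_swap p (on_pure f) xs"
proof -
  let ?F = "on_pure f" and ?a = "xs ! p" and ?b = "xs ! Suc p" and ?us = "take p xs"
  define cs where "cs = drop (p + 2) xs"
  have "multilin (length ?us + Suc (Suc (length cs))) ?F"
    using multilin_on_pure[OF f] p xs by (simp add: cs_def)
  then have T: "trilin (\<lambda>u v c. act_head c (\<lambda>zs. ?F (?us @ u # v # zs)) cs)"
    by (intro trilin_act_head multilin_append)
  then have T': "trilin (\<lambda>c1 c2 b2. act_head b2 (\<lambda>zs. ?F (?us @ (?a * c1) # S c2 # zs)) cs)"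
    by (simp add: trilin_def bilin_def lin_iff distrib_left)
  have split: "xs = ?us @ ?a # ?b # cs"
    using p xs by (simp add: cs_def Cons_nth_drop_Suc)
  have len: "length ?us = p"
    using p xs by simp
  have hopf_swap: "hopf_swap p ?F xs = sweedler ?b (\<lambda>b1 b2. sweedler b1 (\<lambda>c1 c2.
      act_head b2 (\<lambda>zs. ?F (?us @ (?a * c1) # S c2 # zs)) cs))"
    using p xs by (simp add: hopf_swap_nth cs_def)
  show ?thesis
  proof (cases "Suc p < n")
    case True
    then obtain c ds where cs: "cs = c # ds"
      using xs by (cases cs) (auto simp: cs_def)
    have c: "xs ! Suc (Suc p) = c"
      using cs nth_via_drop[of "p + 2" xs c ds] by (simp add: cs_def)
    have upd: "xs[p := x, Suc p := y, Suc (Suc p) := z] = ?us @ x # y # z # ds" for x y z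
    proof -
      have "(?us @ ?a # ?b # c # ds)[p := x, Suc p := y, Suc (Suc p) := z] = ?us @ x # y # z # ds"
        using len by (simp add: list_update_append)
      then show ?thesis by (simp only: split[unfolded cs, symmetric])
    qed
    have "sigma_formula scl \<Delta> S act n (Suc p) f xs
        = - tensor_lift sc (\<lambda>t. act_head (t ! 2) (\<lambda>zs. ?F (?us @ (?a * t ! 0) # S (t ! 1) # zs)) cs)
            (comult_left scl \<Delta> (\<Delta> ?b))"
      using True by (simp add: sigma_formula_def upd c cs on_pure_def)
    also have "\<dots> = - hopf_swap p ?F xs"
      by (simp only: tensor_lift_comult_left[OF T'] hopf_swap)
    finally show ?thesis .
  next
    case False
    then have n: "n = Suc p" using p by simp
    then have cs: "cs = []"
      using xs by (simp add: cs_def)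
    have upd: "xs[p := x, Suc p := y] = ?us @ [x, y]" for x y
    proof -
      have "(?us @ [?a, ?b])[p := x, Suc p := y] = ?us @ [x, y]"
        using len by (simp add: list_update_append)
      then show ?thesis by (simp only: split[unfolded cs, symmetric])
    qed
    have "bilin (\<lambda>c1 c2. act_head 1 (\<lambda>zs. ?F (?us @ (?a * c1) # S c2 # zs)) cs)"
      using T' unfolding trilin_def bilin_def by blast
    then have "lin (\<lambda>b1. sweedler b1 (\<lambda>c1 c2. ?F (?us @ [?a * c1, S c2])))"
      by (simp add: cs lin_iff sweedler_arg_add sweedler_arg_scl)
    from sweedler_counit_right[OF this]
    have "hopf_swap p ?F xs = sweedler ?b (\<lambda>c1 c2. ?F (?us @ [?a * c1, S c2]))"
      by (simp add: hopf_swap cs sweedler_scale)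
    also have "- \<dots> = sigma_formula scl \<Delta> S act n (Suc p) f xs"
      by (simp add: sigma_formula_def n upd on_pure_def sweedler_def)
    finally show ?thesis ..
  qed
qed

text \<open>
  The restriction yields an extensional function, as is required of a bijection of the set of cochains.
\<close>

definition cochain_action :: "nat \<Rightarrow> (nat \<Rightarrow> nat) \<Rightarrow> (('a, 'k) tensor \<Rightarrow> 'm) \<Rightarrow> ('a, 'k) tensor \<Rightarrow> 'm"
  where "cochain_action n \<pi> = (\<lambda>f\<in>cochains scl act n. to_cochain n (perm_action (n + 1) \<pi> (on_pure f)))"

context
  fixes n :: nat and \<pi> :: "nat \<Rightarrow> nat" and f
  assumes \<pi>: "\<pi> permutes {1..n + 1}" and f: "f \<in> cochains scl act n"
begin

lemma cochain_action_in: "cochain_action n \<pi> f \<in> cochains scl act n"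
proof -
  have "to_cochain n (perm_action (n + 1) \<pi> (on_pure f)) \<in> cochains scl act n"
    by (intro to_cochain_in operator_multilin[OF operator_perm_action[OF \<pi>]]
        equivariant_perm_action[OF \<pi>] multilin_on_pure[OF f] equivariant_on_pure[OF f])
  then show ?thesis
    using f by (simp add: cochain_action_def)
qed

lemma on_pure_cochain_action:
  "length xs = n + 1 \<Longrightarrow> on_pure (cochain_action n \<pi> f) xs = perm_action (n + 1) \<pi> (on_pure f) xs"
  using f operator_multilin[OF operator_perm_action[OF \<pi>] multilin_on_pure[OF f]]
  by (simp add: cochain_action_def on_pure_to_cochain)

end

lemma cochain_action_comp:
  assumes \<pi>: "\<pi> permutes {1..n + 1}" and \<tau>: "\<tau> permutes {1..n + 1}" and f: "f \<in> cochains scl act n"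
  shows "cochain_action n (\<pi> \<circ> \<tau>) f = cochain_action n \<pi> (cochain_action n \<tau> f)"
proof (rule cochain_eqI)
  have comp: "\<pi> \<circ> \<tau> permutes {1..n + 1}"
    by (rule permutes_compose[OF \<tau> \<pi>])
  show "cochain_action n (\<pi> \<circ> \<tau>) f \<in> cochains scl act n"
    by (rule cochain_action_in[OF comp f])
  show "cochain_action n \<pi> (cochain_action n \<tau> f) \<in> cochains scl act n"
    by (rule cochain_action_in[OF \<pi> cochain_action_in[OF \<tau> f]])
  fix xs :: "'a list"
  assume xs: "length xs = n + 1"
  have "perm_action (n + 1) \<pi> (perm_action (n + 1) \<tau> (on_pure f)) xs
      = perm_action (n + 1) \<pi> (on_pure (cochain_action n \<tau> f)) xs"
    by (intro operator_cong[OF operator_perm_action[OF \<pi>] _ xs] on_pure_cochain_action[OF \<tau> f, symmetric])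
  then show "on_pure (cochain_action n (\<pi> \<circ> \<tau>) f) xs = on_pure (cochain_action n \<pi> (cochain_action n \<tau> f)) xs"
    by (simp only: on_pure_cochain_action[OF comp f xs] on_pure_cochain_action[OF \<pi> cochain_action_in[OF \<tau> f] xs]
        perm_action_comp[OF multilin_on_pure[OF f] xs \<pi> \<tau>])
qed

lemma cochain_action_id: "f \<in> cochains scl act n \<Longrightarrow> cochain_action n id f = f"
  using cochain_action_in[OF permutes_id] on_pure_cochain_action[OF permutes_id] perm_action_id[OF multilin_on_pure]
  by (intro cochain_eqI) auto

lemma group_action_cochain_action: "group_action (sym_group (n + 1)) (cochains scl act n) (cochain_action n)"
proof -
  let ?E = "cochains scl act n"
  have bij: "cochain_action n \<pi> \<in> Bij ?E" if \<pi>: "\<pi> permutes {1..n + 1}" for \<pi>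
  proof -
    note inv = permutes_inv[OF \<pi>]
    have "bij_betw (cochain_action n \<pi>) ?E ?E"
    proof (rule bij_betw_byWitness[where f' = "cochain_action n (inv' \<pi>)"])
      show "\<forall>f\<in>?E. cochain_action n (inv' \<pi>) (cochain_action n \<pi> f) = f"
        using cochain_action_comp[OF inv \<pi>] cochain_action_id by (simp add: permutes_inv_o(2)[OF \<pi>])
      show "\<forall>f\<in>?E. cochain_action n \<pi> (cochain_action n (inv' \<pi>) f) = f"
        using cochain_action_comp[OF \<pi> inv] cochain_action_id by (simp add: permutes_inv_o(1)[OF \<pi>])
    qed (use cochain_action_in[OF \<pi>] cochain_action_in[OF inv] in auto)
    then show ?thesis
      by (simp add: Bij_def cochain_action_def)
  qed
  have "cochain_action n (\<pi> \<circ> \<tau>) = compose ?E (cochain_action n \<pi>) (cochain_action n \<tau>)"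
    if "\<pi> permutes {1..n + 1}" "\<tau> permutes {1..n + 1}" for \<pi> \<tau>
  proof
    fix f
    show "cochain_action n (\<pi> \<circ> \<tau>) f = compose ?E (cochain_action n \<pi>) (cochain_action n \<tau>) f"
      using cochain_action_comp[OF that, of f] by (cases "f \<in> ?E") (simp_all add: compose_def cochain_action_def[of _ "\<pi> \<circ> \<tau>"])
  qed
  then have "cochain_action n \<in> hom (sym_group (n + 1)) (BijGroup ?E)"
    using bij by (auto simp: hom_def sym_group_def BijGroup_def)
  then show ?thesis
    by (simp add: group_action_def group_hom_def group_hom_axioms_def sym_group_is_group group_BijGroup)
qed

lemma cochains_add:
  assumes "f \<in> cochains scl act n" "g \<in> cochains scl act n"
  shows "(\<lambda>X. f X + g X) \<in> cochains scl act n"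
  using assms unfolding cochains_def by (auto simp: act_add_right)

lemma cochains_scale:
  assumes "f \<in> cochains scl act n"
  shows "(\<lambda>X. sc c (f X)) \<in> cochains scl act n"
  using assms unfolding cochains_def by (auto simp: act_scale V.scale_right_distrib)

lemma is_sigma_action_cochain_action: "is_sigma_action scl \<Delta> S act n (cochain_action n)"
  unfolding is_sigma_action_def
proof (intro conjI ballI allI impI)
  show "group_action (sym_group (n + 1)) (cochains scl act n) (cochain_action n)"
    by (rule group_action_cochain_action)
next
  fix \<pi> f g
  assume "\<pi> \<in> carrier (sym_group (n + 1))" and f: "f \<in> cochains scl act n" and g: "g \<in> cochains scl act n"
  then have \<pi>: "\<pi> permutes {1..n + 1}" by (simp add: sym_group_carrier)
  show "cochain_action n \<pi> (\<lambda>X. f X + g X) = (\<lambda>X. cochain_action n \<pi> f X + cochain_action n \<pi> g X)"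
  proof (rule cochain_eqI)
    fix xs :: "'a list" assume xs: "length xs = n + 1"
    show "on_pure (cochain_action n \<pi> (\<lambda>X. f X + g X)) xs = on_pure (\<lambda>X. cochain_action n \<pi> f X + cochain_action n \<pi> g X) xs"
      using operator_add[OF operator_perm_action[OF \<pi>] xs, of "on_pure f" "on_pure g"]
        on_pure_cochain_action[OF \<pi> f xs] on_pure_cochain_action[OF \<pi> g xs] on_pure_cochain_action[OF \<pi> cochains_add[OF f g] xs]
      by (simp add: on_pure_def[abs_def])
  qed (intro cochain_action_in[OF \<pi>] cochains_add f g)+
next
  fix \<pi> c f
  assume "\<pi> \<in> carrier (sym_group (n + 1))" and f: "f \<in> cochains scl act n"
  then have \<pi>: "\<pi> permutes {1..n + 1}" by (simp add: sym_group_carrier)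
  show "cochain_action n \<pi> (\<lambda>X. sc c (f X)) = (\<lambda>X. sc c (cochain_action n \<pi> f X))"
  proof (rule cochain_eqI)
    fix xs :: "'a list" assume xs: "length xs = n + 1"
    show "on_pure (cochain_action n \<pi> (\<lambda>X. sc c (f X))) xs = on_pure (\<lambda>X. sc c (cochain_action n \<pi> f X)) xs"
      using operator_scale[OF operator_perm_action[OF \<pi>] xs, of c "on_pure f"]
        on_pure_cochain_action[OF \<pi> f xs] on_pure_cochain_action[OF \<pi> cochains_scale[OF f] xs]
      by (simp add: on_pure_def[abs_def])
  qed (intro cochain_action_in[OF \<pi>] cochains_scale f)+
next
  fix i f and xs :: "'a list"
  assume i: "i \<in> {1..n}" and f: "f \<in> cochains scl act n" and xs: "length xs = n + 1"
  then obtain p where p: "i = Suc p" "p < n" by (cases i) auto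
  note t = adjacent_permutes[OF p(2)]
  show "cochain_action n (transpose i (i + 1)) f (pure_tensor scl xs) = sigma_formula scl \<Delta> S act n i f xs"
    using on_pure_cochain_action[OF t f xs] perm_action_adjacent[OF multilin_on_pure[OF f] xs, of p] p
      sigma_formula_eq_hopf_swap[OF f p(2) xs]
    by (simp add: on_pure_def)
qed

context
  fixes n \<rho>
  assumes \<rho>: "is_sigma_action scl \<Delta> S act n \<rho>"
begin

interpretation group_action "sym_group (n + 1)" "cochains scl act n" \<rho>
  using \<rho> by (simp add: is_sigma_action_def)

lemma sigma_action_in: "\<pi> permutes {1..n + 1} \<Longrightarrow> f \<in> cochains scl act n \<Longrightarrow> \<rho> \<pi> f \<in> cochains scl act n"
  by (rule element_image) (auto simp: sym_group_carrier)

lemma sigma_action_comp: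
  assumes "\<pi> permutes {1..n + 1}" "\<tau> permutes {1..n + 1}" "f \<in> cochains scl act n"
  shows "\<rho> (\<pi> \<circ> \<tau>) f = \<rho> \<pi> (\<rho> \<tau> f)"
  using composition_rule[of f \<pi> \<tau>] assms by (simp add: sym_group_carrier sym_group_mult)

lemma sigma_action_id: "f \<in> cochains scl act n \<Longrightarrow> \<rho> id f = f"
  using id_eq_one by (metis restrict_apply' sym_group_one)

lemma sigma_action_undefined:
  "\<pi> permutes {1..n + 1} \<Longrightarrow> f \<notin> cochains scl act n \<Longrightarrow> \<rho> \<pi> f = undefined"
  using bij_prop0[of \<pi>] by (auto simp: Bij_def extensional_def sym_group_carrier)

lemma sigma_action_adjacent:
  assumes "f \<in> cochains scl act n" "p < n" "length xs = n + 1"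
  shows "on_pure (\<rho> (transpose (Suc p) (Suc (Suc p))) f) xs = - hopf_swap p (on_pure f) xs"
proof -
  have "Suc p \<in> {1..n}" using assms(2) by simp
  then have "\<rho> (transpose (Suc p) (Suc p + 1)) f (pure_tensor scl xs) = sigma_formula scl \<Delta> S act n (Suc p) f xs"
    using \<rho> assms(1,3) unfolding is_sigma_action_def by blast
  then show ?thesis
    by (simp add: on_pure_def sigma_formula_eq_hopf_swap[OF assms])
qed

end

lemma sigma_action_unique:
  assumes \<rho>: "is_sigma_action scl \<Delta> S act n \<rho>" and \<rho>': "is_sigma_action scl \<Delta> S act n \<rho>'"
    and "\<pi> permutes {1..n + 1}"
  shows "\<rho> \<pi> = \<rho>' \<pi>"
proof -
  have "\<forall>f\<in>cochains scl act n. \<rho> \<pi> f = \<rho>' \<pi> f"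
    using assms(3)
  proof (induction rule: permutes_adjacent_induct)
    case id
    then show ?case by (metis sigma_action_id[OF \<rho>] sigma_action_id[OF \<rho>'])
  next
    case (adjacent p \<pi>)
    note t = adjacent_permutes[OF adjacent.hyps(1)]
    have generator: "\<rho> (transpose (Suc p) (Suc (Suc p))) g = \<rho>' (transpose (Suc p) (Suc (Suc p))) g"
      if g: "g \<in> cochains scl act n" for g
      by (rule cochain_eqI[OF sigma_action_in[OF \<rho> t g] sigma_action_in[OF \<rho>' t g]])
         (simp add: sigma_action_adjacent[OF \<rho> g adjacent.hyps(1)] sigma_action_adjacent[OF \<rho>' g adjacent.hyps(1)])
    show ?case
    proof
      fix f assume f: "f \<in> cochains scl act n"
      show "\<rho> (transpose (Suc p) (Suc (Suc p)) \<circ> \<pi>) f = \<rho>' (transpose (Suc p) (Suc (Suc p)) \<circ> \<pi>) f"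
        using adjacent.IH f generator[OF sigma_action_in[OF \<rho>' adjacent.hyps(2) f]]
        by (simp only: sigma_action_comp[OF \<rho> t adjacent.hyps(2) f]
            sigma_action_comp[OF \<rho>' t adjacent.hyps(2) f])
    qed
  qed
  then show ?thesis
    using sigma_action_undefined[OF \<rho> assms(3)] sigma_action_undefined[OF \<rho>' assms(3)] by (metis ext)
qed

section \<open>Invariant cochains and the differential\<close>

text \<open>
  A cochain can be evaluated at a class through any representative, so the representatives in the
  definition of \<open>T_diff\<close> may be inserted into the linear extension of \<open>on_pure f\<close>.
\<close>

lemma coboundary_eq_to_cochain:
  assumes f: "f \<in> cochains scl act n"
  shows "coboundary scl \<epsilon> n f = to_cochain (n + 1) (differential (n + 1) (on_pure f))"
proof
  fix X
  let ?N = "n + 1"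
  let ?g = "\<lambda>as. (\<Sum>i<?N. free_scale ((- 1) ^ i) (Poly_Mapping.single (merge_at i as) 1))
            + free_scale ((- 1) ^ ?N * \<epsilon> (as ! ?N)) (Poly_Mapping.single (take ?N as) (1::'k))"
  show "coboundary scl \<epsilon> n f X = to_cochain (n + 1) (differential (n + 1) (on_pure f)) X"
  proof (cases "X \<in> tensor_power scl (?N + 1)")
    case True
    have len: "length as = ?N + 1" if "as \<in> Poly_Mapping.keys (tensor_rep X)" for as
      using that length_free_space[OF tensor_power_rep(1)[OF True]] by simp
    have free: "?g as \<in> free_space ?N" if "length as = ?N + 1" for as
      using that by (intro free_space_add free_space_sum free_space_scale free_space_single)
        (auto simp: merge_at_def)
    have faces: "lin_ext sc (on_pure f) (?g as) = differential ?N (on_pure f) as"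
      if as: "length as = ?N + 1" for as
    proof -
      have "lin_ext sc (on_pure f) (?g as)
          = (\<Sum>i<?N. sc ((- 1) ^ i) (face i (on_pure f) as)) + sc ((- 1) ^ ?N) (face ?N (on_pure f) as)"
        using as face_last[of as ?N "on_pure f"]
        by (simp add: V.lin_ext_add V.lin_ext_sum V.lin_ext_free_scale face_eq_merge del: power_Suc)
      then show ?thesis
        by (simp add: differential_def flip: lessThan_Suc_atMost)
    qed
    have "coboundary scl \<epsilon> n f X = f (tensor_class scl ?N (lin_ext free_scale ?g (tensor_rep X)))"
      using True by (simp add: coboundary_def T_diff_def tensor_map_def)
    also have "\<dots> = lin_ext sc (on_pure f) (lin_ext free_scale ?g (tensor_rep X))"
      by (rule cochain_class[OF f]) (intro free_space_lin_ext free len)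
    also have "\<dots> = lin_ext sc (differential ?N (on_pure f)) (tensor_rep X)"
      unfolding V.lin_ext_lin_ext by (intro lin_ext_cong faces len)
    finally show ?thesis
      using True by (simp add: to_cochain_def tensor_lift_def)
  next
    case False
    then show ?thesis by (simp add: coboundary_def to_cochain_def)
  qed
qed

lemma coboundary_invariant:
  assumes \<rho>: "is_sigma_action scl \<Delta> S act n \<rho>" and \<rho>': "is_sigma_action scl \<Delta> S act (n + 1) \<rho>'"
    and f: "f \<in> invariant_cochains scl act n \<rho>"
  shows "coboundary scl \<epsilon> n f \<in> invariant_cochains scl act (n + 1) \<rho>'"
proof -
  have inv: "f \<in> cochains scl act n" "\<rho> \<pi> f = f" if "\<pi> permutes {1..n + 1}" for \<pi>
    using f that by (auto simp: invariant_cochains_def invariants_def sym_group_carrier)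
  note fC = inv(1)[OF permutes_id]
  let ?F = "on_pure f" and ?d = "coboundary scl \<epsilon> n f"
  have F: "multilin (n + 1) ?F" "equivariant n ?F"
    by (rule multilin_on_pure[OF fC] equivariant_on_pure[OF fC])+
  have D: "multilin (n + 1 + 1) (differential (n + 1) ?F)"
    using multilin_differential[OF F(1)] by simp
  have d: "?d \<in> cochains scl act (n + 1)"
    unfolding coboundary_eq_to_cochain[OF fC]
    by (intro to_cochain_in D equivariant_differential) (simp_all add: F(2))
  have pure: "on_pure ?d xs = differential (n + 1) ?F xs" if "length xs = n + 1 + 1" for xs
    unfolding coboundary_eq_to_cochain[OF fC] by (rule on_pure_to_cochain[OF D that])
  have F_inv: "hopf_swap q ?F ys = - ?F ys" if "Suc q < n + 1" "length ys = n + 1" for q ys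
    using sigma_action_adjacent[OF \<rho> fC _ that(2), of q] inv(2)[OF adjacent_permutes[of q n]] that(1)
    by simp
  have "\<rho>' \<pi> ?d = ?d" if "\<pi> permutes {1..n + 1 + 1}" for \<pi>
    using that
  proof (induction rule: permutes_adjacent_induct)
    case id
    show ?case by (rule sigma_action_id[OF \<rho>' d])
  next
    case (adjacent p \<pi>)
    note t = adjacent_permutes[OF adjacent.hyps(1)]
    have "\<rho>' (transpose (Suc p) (Suc (Suc p))) ?d = ?d"
    proof (rule cochain_eqI[OF sigma_action_in[OF \<rho>' t d] d])
      fix xs :: "'a list"
      assume xs: "length xs = n + 1 + 1"
      have "hopf_swap p (on_pure ?d) xs = hopf_swap p (differential (n + 1) ?F) xs"
        using adjacent.hyps(1) by (intro operator_cong[OF operator_hopf_swap pure xs]) simp_all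
      also have "\<dots> = - differential (n + 1) ?F xs"
        using xs adjacent.hyps(1) by (intro hopf_swap_differential[OF F(1)] F_inv) simp_all
      finally show "on_pure (\<rho>' (transpose (Suc p) (Suc (Suc p))) ?d) xs = on_pure ?d xs"
        by (simp add: sigma_action_adjacent[OF \<rho>' d adjacent.hyps(1) xs] pure[OF xs])
    qed
    then show ?case
      by (simp only: sigma_action_comp[OF \<rho>' t adjacent.hyps(2) d] adjacent.IH)
  qed
  then show ?thesis
    using d by (auto simp: invariant_cochains_def invariants_def sym_group_carrier)
qed

end

section \<open>The symmetric group action and its compatibility with the differential\<close>

theorem proposition3p2:
  fixes scl :: "'k::field \<Rightarrow> 'a::ring_1 \<Rightarrow> 'a"
    and \<Delta> :: "'a \<Rightarrow> ('a, 'k) tensor"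
    and \<epsilon> :: "'a \<Rightarrow> 'k"
    and S :: "'a \<Rightarrow> 'a"
    and act :: "'a \<Rightarrow> 'm::ab_group_add \<Rightarrow> 'm"
  assumes "cocommutative_hopf_algebra scl \<Delta> \<epsilon> S"
    and "left_module act"
  shows "(\<forall>n. (\<exists>\<rho>. is_sigma_action scl \<Delta> S act n \<rho>) \<and>
             (\<forall>\<rho> \<rho>'. is_sigma_action scl \<Delta> S act n \<rho> \<and> is_sigma_action scl \<Delta> S act n \<rho>' \<longrightarrow>
                (\<forall>\<pi>\<in>carrier (sym_group (n + 1)). \<rho> \<pi> = \<rho>' \<pi>))) \<and>
         (\<forall>n \<rho> \<rho>'. is_sigma_action scl \<Delta> S act n \<rho> \<and> is_sigma_action scl \<Delta> S act (n + 1) \<rho>' \<longrightarrow>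
            coboundary scl \<epsilon> n ` invariant_cochains scl act n \<rho>
              \<subseteq> invariant_cochains scl act (n + 1) \<rho>')"
proof -
  interpret hopf_cochains scl \<Delta> \<epsilon> S act
    using assms by (rule hopf_cochains.intro)
  show ?thesis
  proof (intro conjI allI)
    fix n
    show "\<exists>\<rho>. is_sigma_action scl \<Delta> S act n \<rho>"
      using is_sigma_action_cochain_action by blast
  next
    fix n \<rho> \<rho>'
    show "is_sigma_action scl \<Delta> S act n \<rho> \<and> is_sigma_action scl \<Delta> S act n \<rho>' \<longrightarrow>
        (\<forall>\<pi>\<in>carrier (sym_group (n + 1)). \<rho> \<pi> = \<rho>' \<pi>)"
    proof (intro impI ballI, elim conjE)
      fix \<pi>
      assume \<rho>: "is_sigma_action scl \<Delta> S act n \<rho>" "is_sigma_action scl \<Delta> S act n \<rho>'"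
        and \<pi>: "\<pi> \<in> carrier (sym_group (n + 1))"
      show "\<rho> \<pi> = \<rho>' \<pi>"
        by (rule sigma_action_unique[OF \<rho> \<pi>[unfolded sym_group_carrier]])
    qed
  next
    fix n \<rho> \<rho>'
    show "is_sigma_action scl \<Delta> S act n \<rho> \<and> is_sigma_action scl \<Delta> S act (n + 1) \<rho>' \<longrightarrow>
        coboundary scl \<epsilon> n ` invariant_cochains scl act n \<rho> \<subseteq> invariant_cochains scl act (n + 1) \<rho>'"
      by (intro impI image_subsetI, elim conjE) (rule coboundary_invariant)
  qed
qed

end
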